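(* Let $K$ be a real compact nc convex set and let $x\in K$. Then $x$ is maximal in $K$ if and only if $x+i0\in K_c$ is (complex) maximal in the complexification $K_c$.
   Context: Let $\mathbb F=\mathbb R$ or $\mathbb C$, and let $M_{m,n}=M_{m,n}(\mathbb F)$, $M_n = M_n(\mathbb F)$ denote bounded operators between Hilbert spaces $\ell^2_n,\ell^2_m$ for (possibly infinite) cardinals; for an operator space $E$ and a cardinal $n$, $M_n(E)$ is the space of $n\times n$ matrices over $E$ whose finitely supported submatrices are uniformly bounded. Fix a large enough infinite cardinal $\kappa$ (e.g. at least the cardinality of $E$); all cardinals $n,m,\dots$ are nonzero and $\le\kappa$, and $\mathcal M(E)=\bigsqcup_{n\le\kappa}M_n(E)$. A real (resp. complex) nc convex set over a real (resp. complex) dual operator space $E$ is a subset $K=\bigsqcup_n K_n\subseteq\mathcal M(E)$, $K_n\subseteq M_n(E)$, closed under direct sums ($\sum_i\alpha_i x_i\alpha_i^*\in K_n$ whenever $(x_i)$ is a bounded family with $x_i\in K_{n_i}$ and $\alpha_i\in M_{n,n_i}(\mathbb F)$ are isometries with $\sum_i\alpha_i\alpha_i^*=1_n$) and under compressions ($\beta^*x\beta\in K_m$ for $x\in K_n$ and isometries $\beta\in M_{n,m}(\mathbb F)$). It is compact if each $K_n$ is compact in the (point-)weak* topology. Complexification: for $x,y\in M_n(E)$ put $c(x,y)=\begin{bmatrix} x & -y \\ y & x \end{bmatrix}\in M_{2n}(E)$. For a real nc convex set $K\subseteq\mathcal M(E)$, $K_c\subseteq\mathcal M(E_c)$ is the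 complex nc convex set with $(K_c)_n=\{x+iy: x,y\in M_n(E),\ c(x,y)\in K_{2n}\}$; it contains $K$ via $x\mapsto x+i0$. Maximal: for $x\in K_m$, $y\in K_n$, $y$ is a dilation of $x$ if $x=\alpha^*y\alpha$ for an isometry $\alpha\in M_{n,m}(\mathbb F)$; the dilation is trivial if $y$ commutes with the projection $\alpha\alpha^*$. The point $x\in K$ is maximal if every dilation of $x$ (in $K$) is trivial. The scalars $\mathbb F$ are $\mathbb R$ for a real nc convex set and $\mathbb C$ for a complex one. *)

theory Defs
  imports
    "HOL-Analysis.Analysis"
    "HOL-Library.Equipollence"
    "Jordan_Normal_Form.Conjugate"
begin

section \<open>Cardinals and scalar matrices\<close>

text \<open>
  The type \<open>'k\<close> (assumed infinite where it matters) plays the role of the cardinal \<open>\<kappa>\<close>.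
  A nonzero cardinal \<open>n \<le> \<kappa>\<close> is the chosen representative of an equipotence class of nonempty
  subsets of \<open>'k\<close>, and \<open>\<ell>\<^sup>2\<^sub>n\<close> has the elements of that set as its basis indices.
\<close>

definition cardinals :: "'k set set" where
  "cardinals = {I. I \<noteq> {} \<and> I = (SOME J. J \<approx> I)}"

lemma ex1_cardinal:
  fixes A :: "'k set"
  assumes "A \<noteq> {}"
  shows "\<exists>!I :: 'k set. I \<in> cardinals \<and> I \<approx> A"
proof
  define B :: "'k set" where "B = (SOME J. J \<approx> A)"
  have BA: "B \<approx> A"
    unfolding B_def by (rule someI[of "\<lambda>J. J \<approx> A" A]) (rule eqpoll_refl)
  have "(\<lambda>J :: 'k set. J \<approx> B) = (\<lambda>J. J \<approx> A)"
    using BA eqpoll_sym eqpoll_trans by blast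
  then have "B = (SOME J. J \<approx> B)"
    using B_def by metis
  moreover have "B \<noteq> {}"
    using BA assms by (metis eqpoll_empty_iff_empty eqpoll_sym)
  ultimately show "B \<in> cardinals \<and> B \<approx> A"
    using BA by (simp add: cardinals_def)
  fix I :: "'k set" assume I: "I \<in> cardinals \<and> I \<approx> A"
  then have "(\<lambda>J :: 'k set. J \<approx> I) = (\<lambda>J. J \<approx> A)"
    using eqpoll_sym eqpoll_trans by blast
  then show "I = B"
    using I unfolding cardinals_def B_def by (metis (mono_tags, lifting) mem_Collect_eq)
qed

text \<open>
  The scalars \<open>'f\<close> are used only at \<open>real\<close> (where \<^const>\<open>conjugate\<close> is the identity) and
  \<open>complex\<close> (where it is \<^const>\<open>cnj\<close>). Matrices are functions that vanish outside their index
  sets, so products can be formed over the whole index type.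
\<close>

type_synonym ('k, 'a) matr = "'k \<Rightarrow> 'k \<Rightarrow> 'a"

definition mtimes :: "('k, 'f) matr \<Rightarrow> ('k, 'f) matr \<Rightarrow> ('k, 'f::real_normed_field) matr"
    (infixl "\<odot>" 70) where
  "\<alpha> \<odot> \<beta> = (\<lambda>i j. \<Sum>\<^sub>\<infinity>k. \<alpha> i k * \<beta> k j)"

definition adj :: "('k, 'f) matr \<Rightarrow> ('k, 'f::conjugate) matr" where
  "adj \<alpha> = (\<lambda>i j. conjugate (\<alpha> j i))"

definition one_mat :: "'k set \<Rightarrow> ('k, 'f::zero_neq_one) matr" where
  "one_mat I = (\<lambda>i j. if i = j \<and> i \<in> I then 1 else 0)"

text \<open>The operator norm of a finite matrix acting between finite-dimensional \<open>\<ell>\<^sup>2\<close> spaces.\<close>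

definition opnorm :: "'i set \<Rightarrow> 'j set \<Rightarrow> ('i \<Rightarrow> 'j \<Rightarrow> 'f::real_normed_field) \<Rightarrow> real" where
  "opnorm I J A =
     Sup {L2_set (\<lambda>i. norm (\<Sum>j\<in>J. A i j * \<xi> j)) I | \<xi>. L2_set (\<lambda>j. norm (\<xi> j)) J \<le> 1}"

text \<open>\<open>bdd_mat I J\<close> is \<open>M\<^sub>I\<^sub>,\<^sub>J(\<bbbF>)\<close>: the matrices of the bounded operators \<open>\<ell>\<^sup>2\<^sub>J \<rightarrow> \<ell>\<^sup>2\<^sub>I\<close>.\<close>

definition bdd_mat :: "'k set \<Rightarrow> 'k set \<Rightarrow> ('k, 'f::real_normed_field) matr set" where
  "bdd_mat I J = {\<alpha>. (\<forall>i j. i \<notin> I \<or> j \<notin> J \<longrightarrow> \<alpha> i j = 0) \<and>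
     (\<exists>C. \<forall>F G. finite F \<and> F \<subseteq> I \<and> finite G \<and> G \<subseteq> J \<longrightarrow> opnorm F G \<alpha> \<le> C)}"

definition isometry_mat ::
    "'k set \<Rightarrow> 'k set \<Rightarrow> ('k, 'f::{real_normed_field,conjugatable_field}) matr \<Rightarrow> bool" where
  "isometry_mat I J \<alpha> \<longleftrightarrow> \<alpha> \<in> bdd_mat I J \<and> adj \<alpha> \<odot> \<alpha> = one_mat J"

section \<open>Real dual operator spaces\<close>

text \<open>
  \<open>N n u\<close> is the norm of the \<open>n \<times> n\<close> matrix with entries \<open>u i j\<close>, \<open>i, j < n\<close>; that it does not
  depend on the other entries of \<open>u\<close> follows from the first and third conditions. The last two
  conditions are Ruan's axioms. Completeness is not required: a space and its completion have the
  same dual.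
\<close>

definition real_operator_space ::
    "(nat \<Rightarrow> (nat \<Rightarrow> nat \<Rightarrow> 'v::real_vector) \<Rightarrow> real) \<Rightarrow> bool" where
  "real_operator_space N \<longleftrightarrow>
     (\<forall>n u. N n u = 0 \<longleftrightarrow> (\<forall>i<n. \<forall>j<n. u i j = 0)) \<and>
     (\<forall>n c u. N n (\<lambda>i j. c *\<^sub>R u i j) = \<bar>c\<bar> * N n u) \<and>
     (\<forall>n u w. N n (\<lambda>i j. u i j + w i j) \<le> N n u + N n w) \<and>
     (\<forall>m n u w. N (m + n) (\<lambda>i j. if i < m \<and> j < m then u i j
                               else if m \<le> i \<and> m \<le> j then w (i - m) (j - m) else 0)
                = max (N m u) (N n w)) \<and>
     (\<forall>m n a u b. N m (\<lambda>i j. \<Sum>k<n. \<Sum>l<n. (a i k * b l j) *\<^sub>R u k l)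
                \<le> opnorm {..<m} {..<n} a * N n u * opnorm {..<n} {..<m} b)"

text \<open>
  The dual operator space \<open>E\<close> is the operator space dual of its predual \<open>(V, N)\<close>. The norm of
  \<open>M\<^sub>F(E)\<close>, \<open>F\<close> finite, is the completely bounded norm under \<open>M\<^sub>F(E) = CB(V, M\<^sub>F(\<real>))\<close>;
  \<open>norm_le N F C x\<close> says that the \<open>F \<times> F\<close> submatrix of \<open>x\<close> has norm at most \<open>C\<close>, comparing for
  each \<open>p\<close> the norm of \<open>[x\<^sub>i\<^sub>j(u\<^sub>k\<^sub>l)]\<close> with that of \<open>u \<in> M\<^sub>p(V)\<close>.
\<close>

definition dual_space :: "(nat \<Rightarrow> (nat \<Rightarrow> nat \<Rightarrow> 'v::real_vector) \<Rightarrow> real) \<Rightarrow> ('v \<Rightarrow> real) set" where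
  "dual_space N = {f. linear f \<and> (\<exists>C. \<forall>v. \<bar>f v\<bar> \<le> C * N 1 (\<lambda>_ _. v))}"

definition norm_le :: "(nat \<Rightarrow> (nat \<Rightarrow> nat \<Rightarrow> 'v::real_vector) \<Rightarrow> real) \<Rightarrow>
    'k set \<Rightarrow> real \<Rightarrow> ('k, 'v \<Rightarrow> real) matr \<Rightarrow> bool" where
  "norm_le N F C x \<longleftrightarrow>
     (\<forall>p u. opnorm (F \<times> {..<p}) (F \<times> {..<p}) (\<lambda>(i, k) (j, l). x i j (u k l)) \<le> C * N p u)"

definition bdd_by :: "(nat \<Rightarrow> (nat \<Rightarrow> nat \<Rightarrow> 'v::real_vector) \<Rightarrow> real) \<Rightarrow>
    'k set \<Rightarrow> real \<Rightarrow> ('k, 'v \<Rightarrow> real) matr \<Rightarrow> bool" where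
  "bdd_by N I C x \<longleftrightarrow> (\<forall>F. finite F \<and> F \<subseteq> I \<longrightarrow> norm_le N F C x)"

definition dual_matrices :: "(nat \<Rightarrow> (nat \<Rightarrow> nat \<Rightarrow> 'v::real_vector) \<Rightarrow> real) \<Rightarrow>
    'k set \<Rightarrow> ('k, 'v \<Rightarrow> real) matr set" where
  "dual_matrices N I = {x. (\<forall>i\<in>I. \<forall>j\<in>I. x i j \<in> dual_space N) \<and>
     (\<forall>i j. i \<notin> I \<or> j \<notin> I \<longrightarrow> x i j = (\<lambda>v. 0)) \<and> (\<exists>C. bdd_by N I C x)}"

text \<open>
  Evaluation at \<open>v \<in> V\<close> turns a matrix over \<open>E\<close> (\<open>'f = real\<close>) or over \<open>E\<^sub>c\<close> (\<open>'f = complex\<close>)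
  into a scalar matrix; products with scalar matrices are determined by \<open>(\<alpha>x\<beta>)(v) = \<alpha> x(v) \<beta>\<close>,
  that is, the infinite sums converge weak* in \<open>E\<close>.
\<close>

definition eval_mat :: "('k, 'v \<Rightarrow> 'f) matr \<Rightarrow> 'v \<Rightarrow> ('k, 'f) matr" where
  "eval_mat x v = (\<lambda>i j. x i j v)"

definition sandwich :: "('k, 'f) matr \<Rightarrow> ('k, 'v \<Rightarrow> 'f) matr \<Rightarrow> ('k, 'f) matr \<Rightarrow>
    ('k, 'v \<Rightarrow> 'f::real_normed_field) matr" where
  "sandwich \<alpha> x \<beta> = (\<lambda>i j v. (\<alpha> \<odot> eval_mat x v \<odot> \<beta>) i j)"

definition commutes_with :: "('k, 'v \<Rightarrow> 'f) matr \<Rightarrow> ('k, 'f::real_normed_field) matr \<Rightarrow> bool" where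
  "commutes_with y p \<longleftrightarrow> (\<forall>v. p \<odot> eval_mat y v = eval_mat y v \<odot> p)"

text \<open>
  The point-weak* topology of \<open>M\<^sub>I(E) = CB(V, M\<^sub>I(\<real>))\<close>: the coarsest one making \<open>x \<mapsto> \<omega>(x(v))\<close>
  continuous for all \<open>v \<in> V\<close> and all weak* continuous functionals \<open>\<omega>\<close> on \<open>M\<^sub>I(\<real>) = B(\<ell>\<^sup>2\<^sub>I)\<close>.
  The latter are the \<open>A \<mapsto> \<Sum>\<^sub>k \<langle>A \<xi>\<^sub>k, \<eta>\<^sub>k\<rangle>\<close> with \<open>(\<xi>\<^sub>k)\<close> and \<open>(\<eta>\<^sub>k)\<close> square summable.
\<close>

definition normal_functional ::
    "'k set \<Rightarrow> (nat \<Rightarrow> 'k \<Rightarrow> real) \<Rightarrow> (nat \<Rightarrow> 'k \<Rightarrow> real) \<Rightarrow> ('k, real) matr \<Rightarrow> real" where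
  "normal_functional I \<xi> \<eta> A = (\<Sum>\<^sub>\<infinity>k. \<Sum>\<^sub>\<infinity>i\<in>I. \<eta> k i * (\<Sum>\<^sub>\<infinity>j\<in>I. A i j * \<xi> k j))"

definition square_summable :: "'k set \<Rightarrow> (nat \<Rightarrow> 'k \<Rightarrow> real) \<Rightarrow> bool" where
  "square_summable I \<xi> \<longleftrightarrow> (\<lambda>(k, i). (\<xi> k i)\<^sup>2) summable_on (UNIV \<times> I)"

definition point_weak_star :: "(nat \<Rightarrow> (nat \<Rightarrow> nat \<Rightarrow> 'v::real_vector) \<Rightarrow> real) \<Rightarrow>
    'k set \<Rightarrow> ('k, 'v \<Rightarrow> real) matr topology" where
  "point_weak_star N I = topology_generated_by
     {{x \<in> dual_matrices N I. normal_functional I \<xi> \<eta> (eval_mat x v) \<in> U} | v \<xi> \<eta> U.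
        square_summable I \<xi> \<and> square_summable I \<eta> \<and> open U}"

section \<open>Noncommutative convex sets\<close>

text \<open>
  \<open>K = \<Squnion>\<^sub>n K\<^sub>n\<close> is the family of its levels; only \<open>K I\<close> with \<open>I \<in> cardinals\<close> is relevant.
  In a direct sum decomposition the nonzero ranges of the isometries are mutually orthogonal, so
  there are at most \<open>\<kappa>\<close> summands and subsets of \<open>'k\<close> suffice as index sets of families.
\<close>

definition nc_convex_set :: "(nat \<Rightarrow> (nat \<Rightarrow> nat \<Rightarrow> 'v::real_vector) \<Rightarrow> real) \<Rightarrow>
    ('k set \<Rightarrow> ('k, 'v \<Rightarrow> real) matr set) \<Rightarrow> bool" where
  "nc_convex_set N K \<longleftrightarrow>
     (\<forall>n\<in>cardinals. K n \<subseteq> dual_matrices N n) \<and>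
     (\<forall>n\<in>cardinals. \<forall>(T :: 'k set) d x \<alpha> C.
        (\<forall>t\<in>T. d t \<in> cardinals \<and> x t \<in> K (d t) \<and> bdd_by N (d t) C (x t) \<and>
                isometry_mat n (d t) (\<alpha> t)) \<and>
        (\<lambda>i j. \<Sum>\<^sub>\<infinity>t\<in>T. (\<alpha> t \<odot> adj (\<alpha> t)) i j) = one_mat n \<longrightarrow>
        (\<lambda>i j v. \<Sum>\<^sub>\<infinity>t\<in>T. sandwich (\<alpha> t) (x t) (adj (\<alpha> t)) i j v) \<in> K n) \<and>
     (\<forall>n\<in>cardinals. \<forall>m\<in>cardinals. \<forall>x\<in>K n. \<forall>\<beta>.
        isometry_mat n m \<beta> \<longrightarrow> sandwich (adj \<beta>) x \<beta> \<in> K m)"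

definition compact_nc_convex_set :: "(nat \<Rightarrow> (nat \<Rightarrow> nat \<Rightarrow> 'v::real_vector) \<Rightarrow> real) \<Rightarrow>
    ('k set \<Rightarrow> ('k, 'v \<Rightarrow> real) matr set) \<Rightarrow> bool" where
  "compact_nc_convex_set N K \<longleftrightarrow>
     nc_convex_set N K \<and> (\<forall>n\<in>cardinals. compactin (point_weak_star N n) (K n))"

text \<open>
  \<open>dilation n m \<alpha> y x\<close>: \<open>y\<close> at level \<open>n\<close> dilates \<open>x\<close> at level \<open>m\<close> via \<open>\<alpha>\<close>.
  Maximality is relative to the scalars \<open>'f\<close>, from which the isometries are taken.
\<close>

definition dilation :: "'k set \<Rightarrow> 'k set \<Rightarrow> ('k, 'f) matr \<Rightarrow> ('k, 'v \<Rightarrow> 'f) matr \<Rightarrow>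
    ('k, 'v \<Rightarrow> 'f::{real_normed_field,conjugatable_field}) matr \<Rightarrow> bool" where
  "dilation n m \<alpha> y x \<longleftrightarrow> isometry_mat n m \<alpha> \<and> x = sandwich (adj \<alpha>) y \<alpha>"

definition nc_maximal :: "('k set \<Rightarrow> ('k, 'v \<Rightarrow> 'f) matr set) \<Rightarrow> 'k set \<Rightarrow>
    ('k, 'v \<Rightarrow> 'f::{real_normed_field,conjugatable_field}) matr \<Rightarrow> bool" where
  "nc_maximal K m x \<longleftrightarrow> x \<in> K m \<and>
     (\<forall>n\<in>cardinals. \<forall>y\<in>K n. \<forall>\<alpha>. dilation n m \<alpha> y x \<longrightarrow> commutes_with y (\<alpha> \<odot> adj \<alpha>))"

section \<open>Complexification\<close>

text \<open>
  An element \<open>f + ig\<close> of \<open>E\<^sub>c\<close> is the real-linear map \<open>v \<mapsto> f(v) + i g(v)\<close> from \<open>V\<close> to \<open>\<complex>\<close>, or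
  equivalently its complex-linear extension to \<open>V\<^sub>c\<close>, which identifies \<open>E\<^sub>c\<close> with the dual
  of \<open>V\<^sub>c\<close>.
\<close>

definition complex_mat ::
    "('k, 'v \<Rightarrow> real) matr \<Rightarrow> ('k, 'v \<Rightarrow> real) matr \<Rightarrow> ('k, 'v \<Rightarrow> complex) matr" where
  "complex_mat x y = (\<lambda>i j v. Complex (x i j v) (y i j v))"

fun block_mat :: "('k, 'v \<Rightarrow> real) matr \<Rightarrow> ('k, 'v \<Rightarrow> real) matr \<Rightarrow> ('k + 'k, 'v \<Rightarrow> real) matr" where
  "block_mat x y (Inl i) (Inl j) = x i j"
| "block_mat x y (Inl i) (Inr j) = (\<lambda>v. - y i j v)"
| "block_mat x y (Inr i) (Inl j) = y i j"
| "block_mat x y (Inr i) (Inr j) = x i j"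

definition reindex :: "'k set \<Rightarrow> ('k \<Rightarrow> 'l) \<Rightarrow> ('l, 'v \<Rightarrow> real) matr \<Rightarrow> ('k, 'v \<Rightarrow> real) matr" where
  "reindex J b A = (\<lambda>i j. if i \<in> J \<and> j \<in> J then A (b i) (b j) else (\<lambda>v. 0))"

text \<open>
  \<open>c(x, y)\<close> is naturally indexed by two copies \<open>n <+> n\<close> of \<open>n\<close>; the cardinal \<open>l = 2n\<close> is
  matched with these through a bijection \<open>b\<close>. For nc convex \<open>K\<close> the choice of \<open>b\<close> is immaterial,
  as the levels of \<open>K\<close> are invariant under conjugation by permutation matrices.
\<close>

definition complexification :: "(nat \<Rightarrow> (nat \<Rightarrow> nat \<Rightarrow> 'v::real_vector) \<Rightarrow> real) \<Rightarrow>
    ('k set \<Rightarrow> ('k, 'v \<Rightarrow> real) matr set) \<Rightarrow> 'k set \<Rightarrow> ('k, 'v \<Rightarrow> complex) matr set" where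
  "complexification N K n = {complex_mat x y | x y.
     x \<in> dual_matrices N n \<and> y \<in> dual_matrices N n \<and>
     (\<exists>l\<in>cardinals. \<exists>b. bij_betw b l (n <+> n) \<and> reindex l b (block_mat x y) \<in> K l)}"

end

theory Submission
  imports Defs
begin

text \<open>
  A dilation of \<open>x\<close> by \<open>y\<close> in \<open>K\<close> is also a dilation of \<open>x + i0\<close> by \<open>y + i0\<close>, and
  \<open>y + i0\<close> lies in \<open>K\<^sub>c\<close> because \<open>c(y, 0)\<close> is the direct sum of two copies of \<open>y\<close>.
  Conversely, let \<open>z = y + iw\<close> in \<open>K\<^sub>c\<close> dilate \<open>x + i0\<close> via \<open>\<alpha>\<close>. The real isometry \<open>\<beta>\<close> that stacks
  \<open>Re \<alpha>\<close> on \<open>Im \<alpha>\<close> satisfies \<open>\<beta>\<^sup>T c(y, w) \<beta> = Re (\<alpha>\<^sup>* z \<alpha>) = x\<close>, so by maximality \<open>c(y, w)\<close>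
  commutes with \<open>\<beta>\<beta>\<^sup>T\<close>. The same applies to \<open>i\<alpha>\<close>, which yields \<open>\<gamma>\<close>, and
  \<open>\<beta>\<beta>\<^sup>T + \<gamma>\<gamma>\<^sup>T\<close> is the realification of \<open>\<alpha>\<alpha>\<^sup>*\<close>.
\<close>

section \<open>Square summable vectors and bounded matrices\<close>

text \<open>Summing over the whole type agrees with summing over an index set, as matrices here
  vanish off their index sets.\<close>

definition ell2 :: "('k \<Rightarrow> 'f::real_normed_vector) \<Rightarrow> bool" where
  "ell2 p \<longleftrightarrow> (\<lambda>i. (norm (p i))\<^sup>2) summable_on UNIV"

text \<open>A series of nonnegative reals converges exactly when its finite partial sums are
  bounded. This links square summability with \<open>op_bound\<close>, which speaks about finite
  sets only.\<close>

lemma ell2_iff_L2_set_bounded: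
  "ell2 p \<longleftrightarrow> (\<exists>C. \<forall>F. finite F \<longrightarrow> L2_set (\<lambda>i. norm (p i)) F \<le> C)"
proof
  assume "ell2 p"
  then have "L2_set (\<lambda>i. norm (p i)) F \<le> sqrt (\<Sum>\<^sub>\<infinity>i. (norm (p i))\<^sup>2)" if "finite F" for F
    unfolding L2_set_def ell2_def using that by (intro real_sqrt_le_mono finite_sum_le_infsum) auto
  then show "\<exists>C. \<forall>F. finite F \<longrightarrow> L2_set (\<lambda>i. norm (p i)) F \<le> C" by blast
next
  assume "\<exists>C. \<forall>F. finite F \<longrightarrow> L2_set (\<lambda>i. norm (p i)) F \<le> C"
  then obtain C where C: "L2_set (\<lambda>i. norm (p i)) F \<le> C" if "finite F" for F by blast
  have "(\<Sum>i\<in>F. (norm (p i))\<^sup>2) \<le> C\<^sup>2" if "finite F" for F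
  proof -
    have "(\<Sum>i\<in>F. (norm (p i))\<^sup>2) = (L2_set (\<lambda>i. norm (p i)) F)\<^sup>2"
      by (simp add: L2_set_def sum_nonneg)
    also have "\<dots> \<le> C\<^sup>2" using C[OF that] by (intro power_mono) auto
    finally show ?thesis .
  qed
  then show "ell2 p" unfolding ell2_def
    by (intro nonneg_bdd_above_summable_on) (auto simp: bdd_above_def)
qed

text \<open>The inequality \<open>2 * |p i| * |q i| \<le> |p i|^2 + |q i|^2\<close> gives absolute
  convergence by comparison. As \<open>infsum\<close> defaults to 0 on divergent families,
  additivity and inner product arguments about \<open>mtimes\<close> rest on this fact.\<close>

lemma ell2_mult_summable:
  fixes p q :: "'k \<Rightarrow> 'f::{real_normed_field,banach}"
  assumes "ell2 p" "ell2 q"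
  shows "(\<lambda>i. p i * q i) summable_on UNIV"
proof (rule abs_summable_summable[OF summable_on_comparison_test])
  show "(\<lambda>i. (norm (p i))\<^sup>2 + (norm (q i))\<^sup>2) summable_on UNIV"
    using assms by (intro summable_on_add) (auto simp: ell2_def)
  show "norm (p i * q i) \<le> (norm (p i))\<^sup>2 + (norm (q i))\<^sup>2" for i
  proof -
    have "2 * norm (p i) * norm (q i) \<le> (norm (p i))\<^sup>2 + (norm (q i))\<^sup>2"
      by (rule sum_squares_bound)
    moreover have "0 \<le> norm (p i) * norm (q i)" by simp
    ultimately show ?thesis unfolding norm_mult by linarith
  qed
  show "0 \<le> norm (p i * q i)" for i by simp
qed

lemma ell2_cmult: "ell2 p \<Longrightarrow> ell2 (\<lambda>i. c * p i)" for c :: "'f::real_normed_field"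
  unfolding ell2_def norm_mult power_mult_distrib by (rule summable_on_cmult_right)

lemma ell2_cnj: "ell2 (\<lambda>i. cnj (p i)) \<longleftrightarrow> ell2 p"
  by (simp add: ell2_def)

lemma ell2_Complex:
  assumes "ell2 p" "ell2 q"
  shows "ell2 (\<lambda>i. Complex (p i) (q i))"
proof -
  have "(\<lambda>i. (p i)\<^sup>2 + (q i)\<^sup>2) summable_on UNIV"
    using assms by (intro summable_on_add) (auto simp: ell2_def)
  then show ?thesis by (simp add: ell2_def cmod_def)
qed

text \<open>Testing on finitely supported vectors avoids convergence questions in the definition.\<close>

definition op_bound :: "real \<Rightarrow> ('k, 'f::real_normed_field) matr \<Rightarrow> bool" where
  "op_bound C A \<longleftrightarrow> (\<forall>F G \<xi>. finite F \<longrightarrow> finite G \<longrightarrow>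
     L2_set (\<lambda>i. norm (\<Sum>j\<in>G. A i j * \<xi> j)) F \<le> C * L2_set (\<lambda>j. norm (\<xi> j)) G)"

lemma op_boundD:
  assumes "op_bound C A" "finite F" "finite G"
  shows "L2_set (\<lambda>i. norm (\<Sum>j\<in>G. A i j * \<xi> j)) F \<le> C * L2_set (\<lambda>j. norm (\<xi> j)) G"
  using assms unfolding op_bound_def by simp

text \<open>\<open>Sup\<close> on the reals carries information only for sets bounded above. A
  vector of norm at most 1 has entries of norm at most 1, so row \<open>i\<close> contributes at
  most the sum of the norms of its entries.\<close>

lemma opnorm_bdd_above:
  fixes A :: "'i \<Rightarrow> 'j \<Rightarrow> 'f::real_normed_field"
  assumes "finite J"
  shows "bdd_above {L2_set (\<lambda>i. norm (\<Sum>j\<in>J. A i j * \<xi> j)) I | \<xi>. L2_set (\<lambda>j. norm (\<xi> j)) J \<le> 1}"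
proof (rule bdd_aboveI)
  fix s assume "s \<in> {L2_set (\<lambda>i. norm (\<Sum>j\<in>J. A i j * \<xi> j)) I | \<xi>. L2_set (\<lambda>j. norm (\<xi> j)) J \<le> 1}"
  then obtain \<xi> where s: "s = L2_set (\<lambda>i. norm (\<Sum>j\<in>J. A i j * \<xi> j)) I"
    and \<xi>: "L2_set (\<lambda>j. norm (\<xi> j)) J \<le> 1" by blast
  have le: "norm (\<Sum>j\<in>J. A i j * \<xi> j) \<le> (\<Sum>j\<in>J. norm (A i j))" for i
  proof (rule order_trans[OF norm_sum sum_mono])
    fix j assume "j \<in> J"
    then have "norm (\<xi> j) \<le> 1" using member_le_L2_set[OF assms, of j "\<lambda>j. norm (\<xi> j)"] \<xi> by linarith
    then show "norm (A i j * \<xi> j) \<le> norm (A i j)"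
      by (simp add: norm_mult mult_left_le)
  qed
  show "s \<le> L2_set (\<lambda>i. \<Sum>j\<in>J. norm (A i j)) I"
    unfolding s using le by (intro L2_set_mono) auto
qed

text \<open>Homogeneity extends the supremum over the unit ball to every \<xi>: divide by its norm
  over \<open>G\<close>. A vector vanishing on \<open>G\<close> is treated apart.\<close>

lemma opnorm_mult_bound:
  assumes "finite G"
  shows "L2_set (\<lambda>i. norm (\<Sum>j\<in>G. A i j * \<xi> j)) F \<le> opnorm F G A * L2_set (\<lambda>j. norm (\<xi> j)) G"
proof (cases "L2_set (\<lambda>j. norm (\<xi> j)) G = 0")
  case True
  then have "\<forall>j\<in>G. \<xi> j = 0" using assms by (simp add: L2_set_eq_0_iff)
  then show ?thesis using True by (simp add: L2_set_0')
next
  case False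
  define c where "c = L2_set (\<lambda>j. norm (\<xi> j)) G"
  have c: "c > 0" using False L2_set_nonneg[of "\<lambda>j. norm (\<xi> j)" G] unfolding c_def by linarith
  define \<zeta> where "\<zeta> = (\<lambda>j. \<xi> j / of_real c)"
  have "norm (\<zeta> j) = inverse c * norm (\<xi> j)" for j
    using c by (simp add: \<zeta>_def norm_divide field_simps)
  then have "L2_set (\<lambda>j. norm (\<zeta> j)) G = L2_set (\<lambda>j. inverse c * norm (\<xi> j)) G"
    by simp
  also have "\<dots> = inverse c * c"
    unfolding c_def using c c_def by (subst L2_set_right_distrib) auto
  finally have "L2_set (\<lambda>j. norm (\<zeta> j)) G \<le> 1" using c by simp
  then have "L2_set (\<lambda>i. norm (\<Sum>j\<in>G. A i j * \<zeta> j)) F \<le> opnorm F G A"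
    unfolding opnorm_def by (intro cSup_upper opnorm_bdd_above[OF assms]) blast
  moreover have "L2_set (\<lambda>i. norm (\<Sum>j\<in>G. A i j * \<xi> j)) F = c * L2_set (\<lambda>i. norm (\<Sum>j\<in>G. A i j * \<zeta> j)) F"
  proof -
    have "(\<Sum>j\<in>G. A i j * \<xi> j) = of_real c * (\<Sum>j\<in>G. A i j * \<zeta> j)" for i
      using c by (simp add: \<zeta>_def sum_distrib_left)
    then show ?thesis using c by (simp add: norm_mult L2_set_right_distrib)
  qed
  ultimately show ?thesis using c unfolding c_def by (simp add: mult.commute)
qed

lemma opnorm_nonneg: "finite J \<Longrightarrow> 0 \<le> opnorm I J A"
  unfolding opnorm_def
  by (rule order_trans[OF L2_set_nonneg cSup_upper[OF _ opnorm_bdd_above]])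
     (auto intro!: exI[of _ "\<lambda>_. 0"] simp: L2_set_0')

lemma opnorm_leI:
  assumes "\<And>\<xi>. L2_set (\<lambda>j. norm (\<xi> j)) J \<le> 1 \<Longrightarrow> L2_set (\<lambda>i. norm (\<Sum>j\<in>J. A i j * \<xi> j)) I \<le> C"
  shows "opnorm I J A \<le> C"
  unfolding opnorm_def
proof (rule cSup_least)
  show "{L2_set (\<lambda>i. norm (\<Sum>j\<in>J. A i j * \<xi> j)) I |\<xi>. L2_set (\<lambda>j. norm (\<xi> j)) J \<le> 1} \<noteq> {}"
    by (auto intro!: exI[of _ "\<lambda>_. 0"] simp: L2_set_0')
qed (use assms in blast)

text \<open>Entries outside \<open>I \<times> J\<close> are 0, so \<open>F\<close> and
  \<open>G\<close> may be cut down to \<open>F \<inter> I\<close> and \<open>G \<inter> J\<close>;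
  since \<open>C\<close> is nonnegative, the norm of \<xi> over \<open>G \<inter> J\<close> may then
  be replaced by the larger one over \<open>G\<close>.\<close>

lemma op_bound_supportedI:
  assumes supp: "\<And>i j. i \<notin> I \<or> j \<notin> J \<Longrightarrow> A i j = 0"
    and bound: "\<And>F G \<xi>. \<lbrakk>finite F; F \<subseteq> I; finite G; G \<subseteq> J\<rbrakk> \<Longrightarrow>
      L2_set (\<lambda>i. norm (\<Sum>j\<in>G. A i j * \<xi> j)) F \<le> C * L2_set (\<lambda>j. norm (\<xi> j)) G"
    and "0 \<le> C"
  shows "op_bound C A"
  unfolding op_bound_def
proof (intro allI impI)
  fix F G :: "'a set" and \<xi> :: "'a \<Rightarrow> 'b"
  assume fin: "finite F" "finite G"
  have "L2_set (\<lambda>i. norm (\<Sum>j\<in>G. A i j * \<xi> j)) F = L2_set (\<lambda>i. norm (\<Sum>j\<in>G \<inter> J. A i j * \<xi> j)) (F \<inter> I)"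
  proof -
    have "(\<Sum>j\<in>G. A i j * \<xi> j) = (\<Sum>j\<in>G \<inter> J. A i j * \<xi> j)" for i
      using fin supp by (intro sum.mono_neutral_right) auto
    moreover have "(\<Sum>i\<in>F. (norm (\<Sum>j\<in>G \<inter> J. A i j * \<xi> j))\<^sup>2)
        = (\<Sum>i\<in>F \<inter> I. (norm (\<Sum>j\<in>G \<inter> J. A i j * \<xi> j))\<^sup>2)"
      using fin supp by (intro sum.mono_neutral_right) auto
    ultimately show ?thesis by (simp add: L2_set_def)
  qed
  also have "\<dots> \<le> C * L2_set (\<lambda>j. norm (\<xi> j)) (G \<inter> J)"
    using fin by (intro bound) auto
  also have "\<dots> \<le> C * L2_set (\<lambda>j. norm (\<xi> j)) G"
    using fin \<open>0 \<le> C\<close> unfolding L2_set_def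
    by (intro mult_left_mono real_sqrt_le_mono sum_mono2) auto
  finally show "L2_set (\<lambda>i. norm (\<Sum>j\<in>G. A i j * \<xi> j)) F \<le> C * L2_set (\<lambda>j. norm (\<xi> j)) G" .
qed

lemma bdd_mat_op_bound:
  assumes "A \<in> bdd_mat I J"
  obtains C where "op_bound C A"
proof -
  have supp: "\<And>i j. i \<notin> I \<or> j \<notin> J \<Longrightarrow> A i j = 0"
    using assms by (simp add: bdd_mat_def)
  obtain C where "\<forall>F G. finite F \<and> F \<subseteq> I \<and> finite G \<and> G \<subseteq> J \<longrightarrow> opnorm F G A \<le> C"
    using assms unfolding bdd_mat_def by auto
  then have C: "\<And>F G. \<lbrakk>finite F; F \<subseteq> I; finite G; G \<subseteq> J\<rbrakk> \<Longrightarrow> opnorm F G A \<le> C"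
    by simp
  have "op_bound C A"
  proof (rule op_bound_supportedI[where I=I and J=J])
    \<comment> \<open>\<open>C\<close> dominates the operator norm of the empty submatrix, which is
      nonnegative.\<close>
    show "0 \<le> C" using C[of "{}" "{}"] opnorm_nonneg[of "{}" "{}" A] by simp
    show "L2_set (\<lambda>i. norm (\<Sum>j\<in>G. A i j * \<xi> j)) F \<le> C * L2_set (\<lambda>j. norm (\<xi> j)) G"
      if "finite F" "F \<subseteq> I" "finite G" "G \<subseteq> J" for F G \<xi>
      using order_trans[OF opnorm_mult_bound mult_right_mono[OF C[OF that] L2_set_nonneg]] that(3) .
  qed (use supp in auto)
  then show ?thesis using that by blast
qed

lemma bdd_matI:
  assumes "\<And>i j. i \<notin> I \<or> j \<notin> J \<Longrightarrow> A i j = 0" and "op_bound C A"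
  shows "A \<in> bdd_mat I J"
proof -
  \<comment> \<open>The absolute value supplies the nonnegative factor that monotonicity of
    multiplication asks for.\<close>
  have "opnorm F G A \<le> \<bar>C\<bar>" if "finite F" "finite G" for F G
  proof (rule opnorm_leI)
    fix \<xi> :: "'a \<Rightarrow> 'b" assume \<xi>: "L2_set (\<lambda>j. norm (\<xi> j)) G \<le> 1"
    have "L2_set (\<lambda>i. norm (\<Sum>j\<in>G. A i j * \<xi> j)) F \<le> C * L2_set (\<lambda>j. norm (\<xi> j)) G"
      using op_boundD[OF assms(2) that] .
    also have "\<dots> \<le> \<bar>C\<bar> * 1"
      using \<xi> by (intro mult_mono) auto
    finally show "L2_set (\<lambda>i. norm (\<Sum>j\<in>G. A i j * \<xi> j)) F \<le> \<bar>C\<bar>" by simp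
  qed
  then have "\<exists>C. \<forall>F G. finite F \<and> F \<subseteq> I \<and> finite G \<and> G \<subseteq> J \<longrightarrow> opnorm F G A \<le> C"
    by (intro exI[of _ "\<bar>C\<bar>"]) simp
  then show ?thesis using assms(1) unfolding bdd_mat_def by simp
qed

text \<open>With \<open>s\<^sub>j = \<Sum>\<^sub>i A\<^sub>i\<^sub>j \<xi>\<^sub>i\<close> and \<open>\<zeta>\<^sub>j = |s\<^sub>j|\<^sup>2 / s\<^sub>j\<close> (which is \<open>0\<close> if \<open>s\<^sub>j = 0\<close>),
  \<open>\<Sum>\<^sub>j |s\<^sub>j|\<^sup>2 = \<Sum>\<^sub>j s\<^sub>j \<zeta>\<^sub>j = \<Sum>\<^sub>i \<xi>\<^sub>i (A \<zeta>)\<^sub>i\<close>.\<close>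

lemma op_bound_transpose:
  assumes "op_bound C A"
  shows "op_bound C (\<lambda>i j. A j i)"
  unfolding op_bound_def
proof (intro allI impI)
  fix F G :: "'a set" and \<xi> :: "'a \<Rightarrow> 'b"
  assume fin: "finite F" "finite G"
  define s where "s = (\<lambda>i. \<Sum>j\<in>G. A j i * \<xi> j)"
  define \<zeta> where "\<zeta> = (\<lambda>i. of_real ((norm (s i))\<^sup>2) / s i)"
  define S where "S = L2_set (\<lambda>i. norm (s i)) F"
  have norm\<zeta>: "norm (\<zeta> i) = norm (s i)" for i
    by (cases "s i = 0") (auto simp: \<zeta>_def norm_divide power2_eq_square norm_mult)
  have s\<zeta>: "s i * \<zeta> i = of_real ((norm (s i))\<^sup>2)" for i
    by (cases "s i = 0") (auto simp: \<zeta>_def)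
  have "S\<^sup>2 = (\<Sum>i\<in>F. (norm (s i))\<^sup>2)"
    by (simp add: S_def L2_set_def sum_nonneg)
  then have "of_real (S\<^sup>2) = (\<Sum>i\<in>F. s i * \<zeta> i)"
    by (simp add: s\<zeta>)
  also have "\<dots> = (\<Sum>i\<in>F. \<Sum>j\<in>G. \<xi> j * (A j i * \<zeta> i))"
    by (simp add: s_def sum_distrib_left sum_distrib_right ac_simps)
  also have "\<dots> = (\<Sum>j\<in>G. \<xi> j * (\<Sum>i\<in>F. A j i * \<zeta> i))"
    by (subst sum.swap) (simp add: sum_distrib_left)
  finally have "norm (of_real (S\<^sup>2) :: 'b) \<le> (\<Sum>j\<in>G. norm (\<xi> j) * norm (\<Sum>i\<in>F. A j i * \<zeta> i))"
    using norm_sum[of "\<lambda>j. \<xi> j * (\<Sum>i\<in>F. A j i * \<zeta> i)" G] by (simp add: norm_mult)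
  also have "\<dots> \<le> L2_set (\<lambda>j. norm (\<xi> j)) G * L2_set (\<lambda>j. norm (\<Sum>i\<in>F. A j i * \<zeta> i)) G"
    using L2_set_mult_ineq[of "\<lambda>j. norm (\<xi> j)" "\<lambda>j. norm (\<Sum>i\<in>F. A j i * \<zeta> i)" G] by simp
  also have "\<dots> \<le> L2_set (\<lambda>j. norm (\<xi> j)) G * (C * L2_set (\<lambda>i. norm (\<zeta> i)) F)"
    using op_boundD[OF assms fin(2,1)] by (intro mult_left_mono) auto
  finally have "S * S \<le> (C * L2_set (\<lambda>j. norm (\<xi> j)) G) * S"
    unfolding norm\<zeta> S_def[symmetric] by (simp add: power2_eq_square ac_simps norm_mult)
  \<comment> \<open>Dividing by \<open>S\<close> leaves the case \<open>S = 0\<close>, where the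
    bound has to be nonnegative; it is, since it dominates an \<open>L2_set\<close>.\<close>
  moreover have "0 \<le> C * L2_set (\<lambda>j. norm (\<xi> j)) G"
    using order_trans[OF L2_set_nonneg op_boundD[OF assms fin(2) fin(2)]] .
  moreover have "0 \<le> S" by (simp add: S_def)
  ultimately have "S \<le> C * L2_set (\<lambda>j. norm (\<xi> j)) G"
    by (cases "S = 0") auto
  then show "L2_set (\<lambda>i. norm (\<Sum>j\<in>G. A j i * \<xi> j)) F \<le> C * L2_set (\<lambda>j. norm (\<xi> j)) G"
    by (simp add: S_def s_def)
qed

text \<open>A column is the image of a unit vector: test with \<open>G = {j}\<close> and the
  constant vector 1. Rows follow by transposition.\<close>

lemma op_bound_column_ell2:
  assumes "op_bound C A"
  shows "ell2 (\<lambda>i. A i j)"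
  unfolding ell2_iff_L2_set_bounded
proof (intro exI allI impI)
  fix F :: "'a set" assume "finite F"
  then show "L2_set (\<lambda>i. norm (A i j)) F \<le> C"
    using op_boundD[OF assms, of F "{j}" "\<lambda>_. 1"] by simp
qed

lemma op_bound_row_ell2: "op_bound C A \<Longrightarrow> ell2 (\<lambda>j. A i j)"
  using op_bound_column_ell2[OF op_bound_transpose] .

text \<open>For finite \<open>F\<close> the norm over \<open>F\<close> is continuous in the finitely
  many row sums, so the uniform bound for finite \<open>G\<close> survives the limit along finite
  sets. The row sums converge because the rows and \<xi> are square summable.\<close>

lemma op_bound_ell2:
  fixes A :: "('k, 'f::{real_normed_field,banach}) matr"
  assumes "op_bound C A" "ell2 \<xi>"
  shows "ell2 (\<lambda>i. \<Sum>\<^sub>\<infinity>j. A i j * \<xi> j)"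
  unfolding ell2_iff_L2_set_bounded
proof -
  obtain D where D: "\<And>G. finite G \<Longrightarrow> L2_set (\<lambda>j. norm (\<xi> j)) G \<le> D"
    using assms(2) unfolding ell2_iff_L2_set_bounded by blast
  have "L2_set (\<lambda>i. norm (\<Sum>\<^sub>\<infinity>j. A i j * \<xi> j)) F \<le> \<bar>C\<bar> * D" if F: "finite F" for F
  proof (rule tendsto_upperbound)
    have "((\<lambda>G. \<Sum>j\<in>G. A i j * \<xi> j) \<longlongrightarrow> (\<Sum>\<^sub>\<infinity>j. A i j * \<xi> j)) (finite_subsets_at_top UNIV)" for i
      using ell2_mult_summable[OF op_bound_row_ell2[OF assms(1)] assms(2)]
      by (simp add: infsum_tendsto)
    then show "((\<lambda>G. L2_set (\<lambda>i. norm (\<Sum>j\<in>G. A i j * \<xi> j)) F) \<longlongrightarrow>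
        L2_set (\<lambda>i. norm (\<Sum>\<^sub>\<infinity>j. A i j * \<xi> j)) F) (finite_subsets_at_top UNIV)"
      unfolding L2_set_def by (intro tendsto_intros)
    show "\<forall>\<^sub>F G in finite_subsets_at_top UNIV.
        L2_set (\<lambda>i. norm (\<Sum>j\<in>G. A i j * \<xi> j)) F \<le> \<bar>C\<bar> * D"
    proof (rule eventually_finite_subsets_at_top_weakI)
      fix G :: "'k set" assume G: "finite G"
      then have "L2_set (\<lambda>i. norm (\<Sum>j\<in>G. A i j * \<xi> j)) F \<le> C * L2_set (\<lambda>j. norm (\<xi> j)) G"
        by (rule op_boundD[OF assms(1) F])
      also have "\<dots> \<le> \<bar>C\<bar> * D" using D[OF G] by (intro mult_mono) auto
      finally show "L2_set (\<lambda>i. norm (\<Sum>j\<in>G. A i j * \<xi> j)) F \<le> \<bar>C\<bar> * D" .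
    qed
  qed simp
  then show "\<exists>C. \<forall>F. finite F \<longrightarrow> L2_set (\<lambda>i. norm (\<Sum>\<^sub>\<infinity>j. A i j * \<xi> j)) F \<le> C" by blast
qed

text \<open>The 1 by 1 matrix with entry \<open>v\<close>, inserted at \<open>p = 1\<close> into the
  completely bounded norm, turns the uniform bound \<open>B\<close> on \<open>x\<close> into the
  bound \<open>B * N 1 (\<lambda>_ _. v)\<close> for the scalar matrix.\<close>

lemma dual_matrices_eval_op_bound:
  fixes x :: "('k, 'v::real_vector \<Rightarrow> real) matr"
  assumes "x \<in> dual_matrices N I"
  obtains C where "op_bound C (eval_mat x v)"
proof -
  obtain B where B: "bdd_by N I B x" and supp: "\<And>i j. i \<notin> I \<or> j \<notin> I \<Longrightarrow> x i j = (\<lambda>v. 0)"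
    using assms unfolding dual_matrices_def by blast
  define C where "C = B * N 1 (\<lambda>_ _. v)"
  have on: "opnorm (F \<times> {..<1::nat}) (F \<times> {..<1::nat}) (\<lambda>(i, k) (j, l). x i j v) \<le> C"
    if "finite F" "F \<subseteq> I" for F
  proof -
    have "norm_le N F B x" using B that by (simp add: bdd_by_def)
    from this[unfolded norm_le_def, THEN spec[of _ 1], THEN spec[of _ "\<lambda>_ _. v"]]
    show ?thesis unfolding C_def .
  qed
  have "op_bound C (eval_mat x v)"
  proof (rule op_bound_supportedI[where I=I and J=I])
    show "0 \<le> C" by (rule order_trans[OF opnorm_nonneg on[of "{}"]]) auto
    fix F G and \<xi> :: "'k \<Rightarrow> real" assume FG: "finite F" "F \<subseteq> I" "finite G" "G \<subseteq> I"
    \<comment> \<open>\<open>norm_le\<close> bounds square submatrices only, so rows and columns are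
      enlarged to the common set \<open>H\<close> and \<xi> is extended by 0.\<close>
    define H where "H = F \<union> G"
    define \<zeta> where "\<zeta> = (\<lambda>j. if j \<in> G then \<xi> j else 0)"
    have H: "finite H" "H \<subseteq> I" using FG by (auto simp: H_def)
    \<comment> \<open>The factor \<open>{..<1}\<close> that comes from \<open>p = 1\<close> is
      removed by identifying \<open>(j, 0)\<close> with \<open>j\<close>.\<close>
    have pair: "(\<Sum>q\<in>H \<times> {..<1::nat}. f q) = (\<Sum>j\<in>H. f (j, 0))" for f :: "_ \<Rightarrow> real"
    proof -
      have img: "H \<times> {..<1::nat} = (\<lambda>j. (j, 0)) ` H" by auto
      have "inj_on (\<lambda>j. (j, 0::nat)) H" by (rule inj_onI) simp
      then show ?thesis unfolding img by (subst sum.reindex) (auto simp: o_def)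
    qed
    have "(\<Sum>j\<in>H. x i j v * \<zeta> j) = (\<Sum>j\<in>G. x i j v * \<xi> j)" for i
      using H by (intro sum.mono_neutral_cong_right) (auto simp: \<zeta>_def H_def)
    then have "L2_set (\<lambda>i. norm (\<Sum>j\<in>G. eval_mat x v i j * \<xi> j)) F
        = L2_set (\<lambda>i. norm (\<Sum>j\<in>H. x i j v * \<zeta> j)) F"
      by (simp add: eval_mat_def)
    also have "\<dots> \<le> L2_set (\<lambda>i. norm (\<Sum>j\<in>H. x i j v * \<zeta> j)) H"
      using H unfolding L2_set_def by (intro real_sqrt_le_mono sum_mono2) (auto simp: H_def)
    also have "\<dots> = L2_set (\<lambda>p. norm (\<Sum>q\<in>H \<times> {..<1::nat}. (\<lambda>(i, k) (j, l). x i j v) p q * \<zeta> (fst q))) (H \<times> {..<1::nat})"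
      unfolding L2_set_def pair by simp
    also have "\<dots> \<le> C * L2_set (\<lambda>q. norm (\<zeta> (fst q))) (H \<times> {..<1::nat})"
      using H by (intro order_trans[OF opnorm_mult_bound mult_right_mono[OF on]]) auto
    also have "L2_set (\<lambda>q. norm (\<zeta> (fst q))) (H \<times> {..<1::nat}) = L2_set (\<lambda>j. norm (\<xi> j)) G"
      unfolding L2_set_def pair using H
      by (intro arg_cong[where f=sqrt] sum.mono_neutral_cong_right) (auto simp: \<zeta>_def H_def)
    finally show "L2_set (\<lambda>i. norm (\<Sum>j\<in>G. eval_mat x v i j * \<xi> j)) F \<le> C * L2_set (\<lambda>j. norm (\<xi> j)) G" .
  qed (use supp in \<open>auto simp: eval_mat_def\<close>)
  then show ?thesis using that by blast
qed

lemma dual_matrices_eval_ell2: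
  assumes "x \<in> dual_matrices N I"
  shows dual_matrices_eval_column_ell2: "ell2 (\<lambda>i. eval_mat x v i k)"
    and dual_matrices_eval_row_ell2: "ell2 (\<lambda>k. eval_mat x v i k)"
proof -
  obtain C where C: "op_bound C (eval_mat x v)"
    using assms by (rule dual_matrices_eval_op_bound)
  show "ell2 (\<lambda>i. eval_mat x v i k)" using C by (rule op_bound_column_ell2)
  show "ell2 (\<lambda>k. eval_mat x v i k)" using C by (rule op_bound_row_ell2)
qed

lemma has_sum_sum:
  fixes f :: "'i \<Rightarrow> 'k \<Rightarrow> 'a::topological_comm_monoid_add"
  assumes "finite G" "\<And>j. j \<in> G \<Longrightarrow> (f j has_sum s j) A"
  shows "((\<lambda>i. \<Sum>j\<in>G. f j i) has_sum (\<Sum>j\<in>G. s j)) A"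
  using assms by (induction G rule: finite_induct) (auto intro!: has_sum_add)

lemma infsum_single:
  fixes f :: "'a \<Rightarrow> 'b::{comm_monoid_add,t2_space}"
  assumes "\<And>i. i \<noteq> a \<Longrightarrow> f i = 0"
  shows "(\<Sum>\<^sub>\<infinity>i. f i) = f a"
  by (rule infsumI, rule has_sum_finite_neutralI[of "{a}"]) (use assms in auto)

section \<open>Isometries\<close>

definition complex_of_real_mat :: "('k, real) matr \<Rightarrow> ('k, complex) matr" where
  "complex_of_real_mat A = (\<lambda>i j. complex_of_real (A i j))"

lemma complex_of_real_mat_inject: "complex_of_real_mat A = complex_of_real_mat B \<longleftrightarrow> A = B"
  by (auto simp: complex_of_real_mat_def fun_eq_iff)

text \<open>Convergence of the complex copy forces that of \<open>f\<close> by taking real parts, so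
  in the divergent case both sides are the default 0. Hence \<open>complex_of_real_mat\<close>
  respects products without any convergence condition.\<close>

lemma infsum_complex_of_real: "(\<Sum>\<^sub>\<infinity>i\<in>S. complex_of_real (f i)) = complex_of_real (infsum f S)"
proof (cases "f summable_on S")
  case True
  then show ?thesis by (intro infsumI) (simp add: has_sum_of_real)
next
  case False
  then have "\<not> (\<lambda>i. complex_of_real (f i)) summable_on S"
    using summable_on_Re by fastforce
  then show ?thesis using False by (simp add: infsum_not_exists)
qed

lemma complex_of_real_mat_mtimes:
  "complex_of_real_mat (A \<odot> B) = complex_of_real_mat A \<odot> complex_of_real_mat B"
  by (simp add: complex_of_real_mat_def mtimes_def flip: infsum_complex_of_real)

lemma complex_of_real_mat_adj: "complex_of_real_mat (adj A) = adj (complex_of_real_mat A)"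
  by (simp add: complex_of_real_mat_def adj_def)

lemma complex_of_real_mat_one: "complex_of_real_mat (one_mat J) = one_mat J"
  by (auto simp: complex_of_real_mat_def one_mat_def fun_eq_iff)

lemma op_bound_complex_of_real_matD:
  assumes "op_bound C (complex_of_real_mat A)"
  shows "op_bound C A"
  unfolding op_bound_def
proof (intro allI impI)
  fix F G :: "'a set" and \<xi> :: "'a \<Rightarrow> real" assume fin: "finite F" "finite G"
  have sum: "(\<Sum>j\<in>G. complex_of_real_mat A i j * complex_of_real (\<xi> j))
      = complex_of_real (\<Sum>j\<in>G. A i j * \<xi> j)" for i
    by (simp add: complex_of_real_mat_def)
  show "L2_set (\<lambda>i. norm (\<Sum>j\<in>G. A i j * \<xi> j)) F \<le> C * L2_set (\<lambda>j. norm (\<xi> j)) G"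
    using op_boundD[OF assms fin, of "\<lambda>j. complex_of_real (\<xi> j)"]
    unfolding sum norm_of_real by simp
qed

text \<open>Orthonormal columns force \<open>\<parallel>\<alpha> \<xi>\<parallel> \<le> \<parallel>\<xi>\<parallel>\<close> for finitely supported \<open>\<xi>\<close>. The series defining
  \<open>\<alpha>\<^sup>*\<alpha>\<close> do converge on the diagonal, as their value there is \<open>1\<close> and not the junk value \<open>0\<close>.\<close>

lemma isometry_mat_complexI:
  fixes \<alpha> :: "('k, complex) matr"
  assumes supp: "\<And>i j. i \<notin> I \<or> j \<notin> J \<Longrightarrow> \<alpha> i j = 0"
    and ortho: "adj \<alpha> \<odot> \<alpha> = one_mat J"
  shows "isometry_mat I J \<alpha>"
proof -
  have inner: "(\<Sum>\<^sub>\<infinity>i. cnj (\<alpha> i j) * \<alpha> i j') = one_mat J j j'" for j j'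
    using fun_cong[OF fun_cong[OF ortho]] by (simp add: mtimes_def adj_def)
  have col: "ell2 (\<lambda>i. \<alpha> i j)" for j
  proof (cases "j \<in> J")
    case True
    then have "(\<lambda>i. cnj (\<alpha> i j) * \<alpha> i j) summable_on UNIV"
      using inner[of j j] infsum_not_exists by (fastforce simp: one_mat_def)
    then have "(\<lambda>i. Re (cnj (\<alpha> i j) * \<alpha> i j)) summable_on UNIV"
      by (rule summable_on_Re)
    then show ?thesis by (simp add: ell2_def cmod_def power2_eq_square)
  next
    case False
    then show ?thesis by (simp add: ell2_def supp)
  qed
  have inner_sum: "((\<lambda>i. cnj (\<alpha> i j) * \<alpha> i j') has_sum one_mat J j j') UNIV" for j j'
    using ell2_mult_summable[of "\<lambda>i. cnj (\<alpha> i j)"] col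
    by (simp add: has_sum_iff inner ell2_cnj)
  have "op_bound 1 \<alpha>"
    unfolding op_bound_def
  proof (intro allI impI)
    fix F G :: "'k set" and \<xi> :: "'k \<Rightarrow> complex" assume fin: "finite F" "finite G"
    define p where "p = (\<lambda>i. \<Sum>j\<in>G. \<alpha> i j * \<xi> j)"
    \<comment> \<open>The square of the modulus of \<open>p i\<close> is expanded as a finite double
      sum over columns, so that summation over \<open>i\<close> is done termwise; orthonormality
      then removes the off-diagonal terms and the columns outside \<open>J\<close>.\<close>
    have "((\<lambda>i. \<Sum>j\<in>G. \<Sum>j'\<in>G. cnj (\<xi> j) * \<xi> j' * (cnj (\<alpha> i j) * \<alpha> i j')) has_sum
        (\<Sum>j\<in>G. \<Sum>j'\<in>G. cnj (\<xi> j) * \<xi> j' * one_mat J j j')) UNIV"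
      using fin by (intro has_sum_sum has_sum_cmult_right inner_sum)
    moreover have "(\<Sum>j\<in>G. \<Sum>j'\<in>G. cnj (\<xi> j) * \<xi> j' * (cnj (\<alpha> i j) * \<alpha> i j')) = cnj (p i) * p i" for i
      by (subst sum.swap) (simp add: p_def sum_product ac_simps)
    moreover have "(\<Sum>j'\<in>G. cnj (\<xi> j) * \<xi> j' * one_mat J j j') = of_bool (j \<in> J) * (cnj (\<xi> j) * \<xi> j)"
      if "j \<in> G" for j
    proof -
      have "(\<Sum>j'\<in>G. cnj (\<xi> j) * \<xi> j' * one_mat J j j')
          = (\<Sum>j'\<in>{j}. cnj (\<xi> j) * \<xi> j' * one_mat J j j')"
        using that fin by (intro sum.mono_neutral_right) (auto simp: one_mat_def)
      then show ?thesis by (simp add: one_mat_def)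
    qed
    ultimately have "((\<lambda>i. cnj (p i) * p i) has_sum (\<Sum>j\<in>G. of_bool (j \<in> J) * (cnj (\<xi> j) * \<xi> j))) UNIV"
      by simp
    moreover have cnj_mult: "Re (cnj z * z) = (cmod z)\<^sup>2" for z
      unfolding cmod_power2 by (simp add: power2_eq_square)
    moreover have "Re (of_bool c * (cnj z * z)) = of_bool c * (cmod z)\<^sup>2" for c z
      by (cases c) (simp_all only: of_bool_eq mult_1 mult_zero_left cnj_mult zero_complex.sel)
    ultimately have sum:
      "((\<lambda>i. (cmod (p i))\<^sup>2) has_sum (\<Sum>j\<in>G. of_bool (j \<in> J) * (cmod (\<xi> j))\<^sup>2)) UNIV"
      using has_sum_Re by (fastforce simp only: Re_sum)
    have "(\<Sum>i\<in>F. (cmod (p i))\<^sup>2) \<le> (\<Sum>j\<in>G. of_bool (j \<in> J) * (cmod (\<xi> j))\<^sup>2)"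
      using fin by (intro finite_sum_le_has_sum[OF sum]) auto
    also have "\<dots> \<le> (\<Sum>j\<in>G. (cmod (\<xi> j))\<^sup>2)"
      by (intro sum_mono) auto
    finally show "L2_set (\<lambda>i. norm (\<Sum>j\<in>G. \<alpha> i j * \<xi> j)) F \<le> 1 * L2_set (\<lambda>j. norm (\<xi> j)) G"
      by (simp add: L2_set_def p_def)
  qed
  then have "\<alpha> \<in> bdd_mat I J" using supp by (intro bdd_matI)
  then show ?thesis using ortho by (simp add: isometry_mat_def)
qed

text \<open>The complex copy of \<alpha> meets the conditions of
  \<open>isometry_mat_complexI\<close>; the operator bound obtained there restricts to real test
  vectors.\<close>

lemma isometry_mat_realI:
  fixes \<alpha> :: "('k, real) matr"
  assumes supp: "\<And>i j. i \<notin> I \<or> j \<notin> J \<Longrightarrow> \<alpha> i j = 0"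
    and ortho: "adj \<alpha> \<odot> \<alpha> = one_mat J"
  shows "isometry_mat I J \<alpha>"
proof -
  have "isometry_mat I J (complex_of_real_mat \<alpha>)"
    using supp ortho
    by (intro isometry_mat_complexI)
       (auto simp: complex_of_real_mat_one simp flip: complex_of_real_mat_mtimes complex_of_real_mat_adj,
        auto simp: complex_of_real_mat_def)
  then obtain C where "op_bound C (complex_of_real_mat \<alpha>)"
    using bdd_mat_op_bound unfolding isometry_mat_def by blast
  then have "\<alpha> \<in> bdd_mat I J"
    using supp by (intro bdd_matI op_bound_complex_of_real_matD)
  then show ?thesis using ortho by (simp add: isometry_mat_def)
qed

lemma isometry_mat_complex_of_real_mat:
  assumes "isometry_mat I J \<alpha>"
  shows "isometry_mat I J (complex_of_real_mat \<alpha>)"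
proof (rule isometry_mat_complexI)
  show "complex_of_real_mat \<alpha> i j = 0" if "i \<notin> I \<or> j \<notin> J" for i j
    using assms that by (auto simp: isometry_mat_def bdd_mat_def complex_of_real_mat_def)
  show "adj (complex_of_real_mat \<alpha>) \<odot> complex_of_real_mat \<alpha> = one_mat J"
    using assms
    by (simp add: isometry_mat_def complex_of_real_mat_one flip: complex_of_real_mat_mtimes complex_of_real_mat_adj)
qed

section \<open>Realification\<close>

text \<open>A complex vector over \<open>n\<close> becomes the real vector over \<open>l\<close> formed by its real and imaginary
  parts, where \<open>b\<close> matches \<open>l\<close> with \<open>n <+> n\<close>; a complex matrix \<open>x + iy\<close> becomes \<open>c(x, y)\<close>.
  The units let both copies of \<open>n\<close> be treated at once, since \<open>Im z = Re (-iz)\<close>.\<close>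

definition copy_unit :: "'k + 'k \<Rightarrow> complex" where
  "copy_unit = case_sum (\<lambda>_. 1) (\<lambda>_. \<i>)"

definition copy_index :: "'k + 'k \<Rightarrow> 'k" where
  "copy_index = case_sum id id"

lemma copy_simps [simp]:
  "copy_unit (Inl a) = 1" "copy_unit (Inr a) = \<i>"
  "copy_index (Inl a) = a" "copy_index (Inr a) = a"
  by (simp_all add: copy_unit_def copy_index_def)

definition realify :: "'k set \<Rightarrow> ('k \<Rightarrow> 'k + 'k) \<Rightarrow> ('k \<Rightarrow> complex) \<Rightarrow> 'k \<Rightarrow> real" where
  "realify l b p i = (if i \<in> l then Re (cnj (copy_unit (b i)) * p (copy_index (b i))) else 0)"

definition realify_mat :: "'k set \<Rightarrow> ('k \<Rightarrow> 'k + 'k) \<Rightarrow> ('k, complex) matr \<Rightarrow> ('k, real) matr" where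
  "realify_mat l b A i k = (if i \<in> l \<and> k \<in> l
     then Re (cnj (copy_unit (b i)) * copy_unit (b k) * A (copy_index (b i)) (copy_index (b k))) else 0)"

lemma realify_mat_column:
  "k \<in> l \<Longrightarrow> realify_mat l b A i k = realify l b (\<lambda>j. copy_unit (b k) * A j (copy_index (b k))) i"
  by (simp add: realify_mat_def realify_def mult.assoc)

text \<open>The pairing in \<open>realify_has_sum\<close> conjugates its first argument, so a row
  has to enter as the conjugate of the complex row.\<close>

lemma realify_mat_row:
  "i \<in> l \<Longrightarrow> realify_mat l b A i k = realify l b (\<lambda>j. copy_unit (b i) * cnj (A (copy_index (b i)) j)) k"
  by (simp add: realify_mat_def realify_def algebra_simps)

text \<open>On the four blocks, read row by row,
  \<open>cnj (copy_unit (b i)) * copy_unit (b k)\<close> is 1, \<open>\<i>\<close>,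
  \<open>-\<i>\<close>, 1. For \<open>z = x + \<i> y\<close> the real parts of \<open>z\<close>,
  \<open>\<i> z\<close>, \<open>-\<i> z\<close>, \<open>z\<close> are \<open>x\<close>,
  \<open>-y\<close>, \<open>y\<close>, \<open>x\<close>.\<close>

lemma eval_mat_reindex_block_mat:
  "eval_mat (reindex l b (block_mat x y)) v = realify_mat l b (eval_mat (complex_mat x y) v)"
proof (intro ext)
  fix i k
  show "eval_mat (reindex l b (block_mat x y)) v i k = realify_mat l b (eval_mat (complex_mat x y) v) i k"
    by (cases "b i"; cases "b k") (auto simp: eval_mat_def reindex_def realify_mat_def complex_mat_def)
qed

section \<open>Inner products and matrix products under realification\<close>

locale doubling =
  fixes l n :: "'k set" and b :: "'k \<Rightarrow> 'k + 'k"
  assumes bij: "bij_betw b l (n <+> n)"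
begin

text \<open>The bijection splits \<open>l\<close> into one copy of \<open>n\<close> carrying
  \<open>f\<close> and one carrying \<open>g\<close>; the vanishing conditions turn sums over
  \<open>UNIV\<close> into sums over \<open>n\<close>.\<close>

lemma has_sum_double:
  fixes f g :: "'k \<Rightarrow> real"
  assumes "(f has_sum s) UNIV" "(g has_sum t) UNIV" "\<And>a. a \<notin> n \<Longrightarrow> f a = 0" "\<And>a. a \<notin> n \<Longrightarrow> g a = 0"
  shows "((\<lambda>i. if i \<in> l then case_sum f g (b i) else 0) has_sum (s + t)) UNIV"
proof -
  have "(f has_sum s) n" "(g has_sum t) n"
    using assms(1,2)
    by (auto intro: has_sum_cong_neutral[THEN iffD1, rotated -1] simp: assms(3,4))
  then have "(case_sum f g has_sum s) (Inl ` n)" "(case_sum f g has_sum t) (Inr ` n)"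
    by (simp_all add: has_sum_reindex inj_on_def o_def)
  then have "(case_sum f g has_sum (s + t)) (n <+> n)"
    unfolding Plus_def by (rule has_sum_Un_disjoint) auto
  then have "((\<lambda>i. case_sum f g (b i)) has_sum (s + t)) l"
    using has_sum_reindex_bij_betw[OF bij] by blast
  then show ?thesis
    by (rule has_sum_cong_neutral[THEN iffD1, rotated -1]) auto
qed

text \<open>In \<open>Re (cnj p * q) = Re p * Re q + Im p * Im q\<close> the first products are
  summed over one copy of \<open>n\<close> and the second over the other. Realification thus turns
  the complex inner product into its real part.\<close>

lemma realify_has_sum:
  assumes "ell2 p" "ell2 q" and supp: "\<And>i. i \<notin> n \<Longrightarrow> p i = 0"
  shows "((\<lambda>i. realify l b p i * realify l b q i) has_sum Re (\<Sum>\<^sub>\<infinity>i. cnj (p i) * q i)) UNIV"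
proof -
  have sub: "ell2 (\<lambda>i. Re (r i))" "ell2 (\<lambda>i. Im (r i))" if "ell2 r" for r :: "'k \<Rightarrow> complex"
    using that abs_Re_le_cmod abs_Im_le_cmod unfolding ell2_def
    by (auto intro!: summable_on_comparison_test[of "\<lambda>i. (cmod (r i))\<^sup>2"] simp: abs_le_square_iff[symmetric])
  obtain s t where s: "((\<lambda>i. Re (p i) * Re (q i)) has_sum s) UNIV"
    and t: "((\<lambda>i. Im (p i) * Im (q i)) has_sum t) UNIV"
    using ell2_mult_summable[OF sub(1)[OF assms(1)] sub(1)[OF assms(2)]]
      ell2_mult_summable[OF sub(2)[OF assms(1)] sub(2)[OF assms(2)]] by (auto simp: summable_on_def)
  have "((\<lambda>i. Re (cnj (p i) * q i)) has_sum Re (\<Sum>\<^sub>\<infinity>i. cnj (p i) * q i)) UNIV"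
    using ell2_mult_summable[of "\<lambda>i. cnj (p i)" q] assms
    by (intro has_sum_Re) (simp add: ell2_cnj)
  moreover have "((\<lambda>i. Re (cnj (p i) * q i)) has_sum (s + t)) UNIV"
    using has_sum_add[OF s t] by simp
  ultimately have "s + t = Re (\<Sum>\<^sub>\<infinity>i. cnj (p i) * q i)" using has_sum_unique by blast
  moreover have "(if i \<in> l then case_sum (\<lambda>i. Re (p i) * Re (q i)) (\<lambda>i. Im (p i) * Im (q i)) (b i) else 0)
      = realify l b p i * realify l b q i" for i
    by (cases "b i") (auto simp: realify_def)
  ultimately show ?thesis
    using has_sum_double[OF s t] supp by simp
qed

text \<open>Restricting the convergent sum to each copy of \<open>n\<close> gives square summable
  real and imaginary parts. It serves for vectors whose square summability is first known after
  realification.\<close>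

lemma ell2_realifyD:
  assumes "ell2 (realify l b p)" and supp: "\<And>i. i \<notin> n \<Longrightarrow> p i = 0"
  shows "ell2 p"
proof -
  define f where "f = case_sum (\<lambda>i. (Re (p i))\<^sup>2) (\<lambda>i. (Im (p i))\<^sup>2)"
  have "(\<lambda>i. (realify l b p i)\<^sup>2) summable_on l"
    using assms(1) summable_on_subset_banach unfolding ell2_def by fastforce
  moreover have "(realify l b p i)\<^sup>2 = f (b i)" if "i \<in> l" for i
    using that by (cases "b i") (auto simp: realify_def f_def)
  ultimately have "(\<lambda>i. f (b i)) summable_on l"
    by (simp cong: summable_on_cong)
  then have "f summable_on (n <+> n)"
    using summable_on_reindex_bij_betw[OF bij] by blast
  then have "f summable_on (Inl ` n)" "f summable_on (Inr ` n)"
    by (auto elim!: summable_on_subset_banach)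
  then have "(\<lambda>i. (Re (p i))\<^sup>2) summable_on n" "(\<lambda>i. (Im (p i))\<^sup>2) summable_on n"
    by (simp_all add: summable_on_reindex inj_on_def o_def f_def)
  from summable_on_add[OF this] have "(\<lambda>i. (cmod (p i))\<^sup>2) summable_on n"
    by (simp add: cmod_power2)
  then show ?thesis unfolding ell2_def
    by (rule summable_on_cong_neutral[THEN iffD1, rotated -1]) (auto simp: supp)
qed

text \<open>Each entry is an inner product of a row with a column, handled by
  \<open>realify_has_sum\<close>; the units of the two copies leave the sum as the factor
  \<open>u\<close>.\<close>

lemma realify_mat_mtimes:
  assumes "\<And>i. ell2 (\<lambda>j. A i j)" "\<And>k. ell2 (\<lambda>j. B j k)" and supp: "\<And>i j. j \<notin> n \<Longrightarrow> A i j = 0"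
  shows "realify_mat l b A \<odot> realify_mat l b B = realify_mat l b (A \<odot> B)"
proof (intro ext)
  fix i k
  show "(realify_mat l b A \<odot> realify_mat l b B) i k = realify_mat l b (A \<odot> B) i k"
  proof (cases "i \<in> l \<and> k \<in> l")
    case True
    define u where "u = cnj (copy_unit (b i)) * copy_unit (b k)"
    have "((\<lambda>j. realify_mat l b A i j * realify_mat l b B j k) has_sum
        Re (\<Sum>\<^sub>\<infinity>j. cnj (copy_unit (b i) * cnj (A (copy_index (b i)) j)) *
          (copy_unit (b k) * B j (copy_index (b k))))) UNIV"
      using True assms
      by (simp only: realify_mat_row realify_mat_column) (intro realify_has_sum ell2_cmult; simp add: ell2_cnj)
    also have "(\<lambda>j. cnj (copy_unit (b i) * cnj (A (copy_index (b i)) j)) *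
        (copy_unit (b k) * B j (copy_index (b k))))
        = (\<lambda>j. u * (A (copy_index (b i)) j * B j (copy_index (b k))))"
      by (simp add: u_def ac_simps)
    finally show ?thesis
      using True by (simp add: infsumI mtimes_def realify_mat_def infsum_cmult_right' u_def)
  qed (auto simp: mtimes_def realify_mat_def)
qed

text \<open>\<open>Re (A i k)\<close> is the entry at the copies \<open>Inl i\<close>,
  \<open>Inl k\<close>, and \<open>Im (A i k)\<close> is the one at \<open>Inr i\<close>,
  \<open>Inl k\<close>.\<close>

lemma realify_mat_inject:
  assumes "realify_mat l b A = realify_mat l b B"
    and "\<And>i k. i \<notin> n \<or> k \<notin> n \<Longrightarrow> A i k = 0" "\<And>i k. i \<notin> n \<or> k \<notin> n \<Longrightarrow> B i k = 0"
  shows "A = B"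
proof (intro ext)
  fix i k
  show "A i k = B i k"
  proof (cases "i \<in> n \<and> k \<in> n")
    case True
    then have "Inl i \<in> b ` l" "Inr i \<in> b ` l" "Inl k \<in> b ` l"
      using bij by (auto simp: bij_betw_def)
    then obtain i1 i2 k1 where "i1 \<in> l" "b i1 = Inl i" "i2 \<in> l" "b i2 = Inr i" "k1 \<in> l" "b k1 = Inl k"
      by (metis imageE)
    then show ?thesis
      using fun_cong[OF fun_cong[OF assms(1)], of i1 k1] fun_cong[OF fun_cong[OF assms(1)], of i2 k1]
      by (auto simp: realify_mat_def intro: complex_eqI)
  qed (use assms(2,3) in auto)
qed

end

section \<open>Range projections, and multiplication of an isometry by the imaginary unit\<close>

lemma isometry_mat_supp: "isometry_mat I J \<alpha> \<Longrightarrow> i \<notin> I \<or> j \<notin> J \<Longrightarrow> \<alpha> i j = 0"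
  by (simp add: isometry_mat_def bdd_mat_def)

lemma isometry_mat_op_bound:
  assumes "isometry_mat I J \<alpha>"
  obtains C where "op_bound C \<alpha>"
proof -
  have "\<alpha> \<in> bdd_mat I J" using assms by (simp add: isometry_mat_def)
  then show thesis by (rule bdd_mat_op_bound) (rule that)
qed

lemma isometry_mat_ell2:
  assumes "isometry_mat I J \<alpha>"
  shows isometry_mat_column_ell2: "ell2 (\<lambda>i. \<alpha> i j)"
    and isometry_mat_row_ell2: "ell2 (\<lambda>j. \<alpha> i j)"
proof -
  obtain C where C: "op_bound C \<alpha>" using assms by (rule isometry_mat_op_bound)
  show "ell2 (\<lambda>i. \<alpha> i j)" using C by (rule op_bound_column_ell2)
  show "ell2 (\<lambda>j. \<alpha> i j)" using C by (rule op_bound_row_ell2)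
qed

text \<open>Column \<open>k\<close> of the projection is \<alpha> applied to row \<open>k\<close> of
  \<alpha>, which is square summable.\<close>

lemma range_projection_column_ell2_real:
  fixes \<alpha> :: "('k, real) matr"
  assumes "isometry_mat I J \<alpha>"
  shows "ell2 (\<lambda>i. (\<alpha> \<odot> adj \<alpha>) i k)"
proof -
  obtain C where "op_bound C \<alpha>" using isometry_mat_op_bound[OF assms] .
  then show ?thesis
    using op_bound_ell2 isometry_mat_row_ell2[OF assms] unfolding mtimes_def adj_def by fastforce
qed

lemma range_projection_column_ell2_complex:
  fixes \<alpha> :: "('k, complex) matr"
  assumes "isometry_mat I J \<alpha>"
  shows "ell2 (\<lambda>i. (\<alpha> \<odot> adj \<alpha>) i k)"
proof -
  obtain C where C: "op_bound C \<alpha>" using isometry_mat_op_bound[OF assms] .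
  have "ell2 (\<lambda>j. cnj (\<alpha> k j))" using isometry_mat_row_ell2[OF assms] by (simp add: ell2_cnj)
  from op_bound_ell2[OF C this] show ?thesis by (simp add: mtimes_def adj_def)
qed

lemma range_projection_adj_real:
  fixes \<alpha> :: "('k, real) matr"
  shows "(\<alpha> \<odot> adj \<alpha>) i k = (\<alpha> \<odot> adj \<alpha>) k i"
  by (simp add: mtimes_def adj_def mult.commute)

lemma range_projection_adj_complex:
  fixes \<alpha> :: "('k, complex) matr"
  shows "(\<alpha> \<odot> adj \<alpha>) i k = cnj ((\<alpha> \<odot> adj \<alpha>) k i)"
  by (simp add: mtimes_def adj_def mult.commute flip: infsum_cnj)

lemma isometry_mat_times_i:
  assumes "isometry_mat I J \<alpha>"
  shows "isometry_mat I J (\<lambda>i j. \<i> * \<alpha> i j)"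
proof (rule isometry_mat_complexI)
  show "adj (\<lambda>i j. \<i> * \<alpha> i j) \<odot> (\<lambda>i j. \<i> * \<alpha> i j) = one_mat J"
  proof -
    have "adj (\<lambda>i j. \<i> * \<alpha> i j) \<odot> (\<lambda>i j. \<i> * \<alpha> i j) = adj \<alpha> \<odot> \<alpha>"
      by (simp add: mtimes_def adj_def algebra_simps)
    then show ?thesis using assms by (simp add: isometry_mat_def)
  qed
qed (use isometry_mat_supp[OF assms] in auto)

text \<open>The outer scalars \<open>-\<i>\<close> and \<open>\<i>\<close> multiply to 1, and
  scalars leave \<open>infsum\<close> even without convergence. So \<open>\<i>\<close> times
  \<alpha> compresses the same dilation to the same point, which provides the second real
  isometry.\<close>

lemma sandwich_times_i:
  "sandwich (adj (\<lambda>i j. \<i> * \<alpha> i j)) z (\<lambda>i j. \<i> * \<alpha> i j) = sandwich (adj \<alpha>) z \<alpha>"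
proof -
  have "(\<Sum>\<^sub>\<infinity>i. - (\<i> * cnj (\<alpha> i j)) * z i k v) = - \<i> * (\<Sum>\<^sub>\<infinity>i. cnj (\<alpha> i j) * z i k v)" for j k v
    by (subst infsum_cmult_right'[symmetric]) (simp add: mult.assoc)
  then show ?thesis
    by (simp add: sandwich_def mtimes_def adj_def eval_mat_def fun_eq_iff algebra_simps)
qed

lemma dilation_times_i:
  "dilation n m \<alpha> z x \<Longrightarrow> dilation n m (\<lambda>i j. \<i> * \<alpha> i j) z x"
  by (simp add: dilation_def isometry_mat_times_i sandwich_times_i)

text \<open>This stacks \<open>Re \<alpha>\<close> on \<open>Im \<alpha>\<close>. Only the rows are
  doubled; the columns keep their index set, as the compression must land at the level of
  \<open>x\<close>.\<close>

definition realify_columns ::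
    "'k set \<Rightarrow> ('k \<Rightarrow> 'k + 'k) \<Rightarrow> ('k, complex) matr \<Rightarrow> ('k, real) matr" where
  "realify_columns l b \<alpha> = (\<lambda>i j. realify l b (\<lambda>i. \<alpha> i j) i)"

context doubling
begin

text \<open>Inner products of realified columns are the real parts of those of the columns of
  \<alpha>, and \<open>one_mat\<close> has real entries.\<close>

lemma realify_columns_isometry_mat:
  assumes "isometry_mat n m \<alpha>"
  shows "isometry_mat l m (realify_columns l b \<alpha>)"
proof (rule isometry_mat_realI)
  show "realify_columns l b \<alpha> i j = 0" if "i \<notin> l \<or> j \<notin> m" for i j
    using that isometry_mat_supp[OF assms] by (auto simp: realify_columns_def realify_def)
  show "adj (realify_columns l b \<alpha>) \<odot> realify_columns l b \<alpha> = one_mat m"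
  proof (intro ext)
    fix j j'
    have "(adj (realify_columns l b \<alpha>) \<odot> realify_columns l b \<alpha>) j j'
        = Re (\<Sum>\<^sub>\<infinity>i. cnj (\<alpha> i j) * \<alpha> i j')"
      unfolding mtimes_def adj_def realify_columns_def conjugate_real_def
      by (intro infsumI realify_has_sum isometry_mat_column_ell2[OF assms] isometry_mat_supp[OF assms]) simp
    also have "\<dots> = Re ((adj \<alpha> \<odot> \<alpha>) j j')"
      by (simp add: mtimes_def adj_def)
    also have "\<dots> = one_mat m j j'"
      using assms by (auto simp: isometry_mat_def one_mat_def)
    finally show "(adj (realify_columns l b \<alpha>) \<odot> realify_columns l b \<alpha>) j j' = one_mat m j j'" .
  qed
qed

text \<open>Row \<open>j\<close> of the left product is the realification of the vector
  \<open>u\<close> below, so pairing it with column \<open>j'\<close> again gives a real part. The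
  bound concerns the realified matrix since in the application that matrix evaluates a point of
  \<open>K\<close>.\<close>

lemma realify_columns_compression:
  assumes \<alpha>: "isometry_mat n m \<alpha>" and Z: "op_bound C (realify_mat l b Z)"
    and col: "\<And>k. ell2 (\<lambda>i. Z i k)" and supp: "\<And>i k. k \<notin> n \<Longrightarrow> Z i k = 0"
  shows "(adj (realify_columns l b \<alpha>) \<odot> realify_mat l b Z \<odot> realify_columns l b \<alpha>) j j'
    = Re ((adj \<alpha> \<odot> Z \<odot> \<alpha>) j j')"
proof -
  note colA = isometry_mat_column_ell2[OF \<alpha>] and suppA = isometry_mat_supp[OF \<alpha>]
  \<comment> \<open>The outer conjugate compensates for the conjugation of the first argument in
    \<open>realify_has_sum\<close>.\<close>
  define u where "u = (\<lambda>k. cnj (\<Sum>\<^sub>\<infinity>i. cnj (\<alpha> i j) * Z i k))"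
  have u_supp: "u k = 0" if "k \<notin> n" for k using that supp by (simp add: u_def)
  have row: "(\<Sum>\<^sub>\<infinity>i. realify_columns l b \<alpha> i j * realify_mat l b Z i k) = realify l b u k" for k
  proof (cases "k \<in> l")
    case True
    have "(\<Sum>\<^sub>\<infinity>i. realify_columns l b \<alpha> i j * realify_mat l b Z i k)
      = Re (\<Sum>\<^sub>\<infinity>i. cnj (\<alpha> i j) * (copy_unit (b k) * Z i (copy_index (b k))))"
      unfolding realify_columns_def realify_mat_column[OF True]
      by (intro infsumI realify_has_sum colA ell2_cmult col) (simp add: suppA)
    also have "(\<Sum>\<^sub>\<infinity>i. cnj (\<alpha> i j) * (copy_unit (b k) * Z i (copy_index (b k))))
        = copy_unit (b k) * cnj (u (copy_index (b k)))"
      by (simp add: u_def mult.left_commute flip: infsum_cmult_right')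
    also have "Re \<dots> = realify l b u k"
      using True by (simp add: realify_def)
    finally show ?thesis .
  qed (simp add: realify_mat_def realify_def)
  \<comment> \<open>The transpose of the realified \<open>Z\<close> is bounded and so keeps vectors
    square summable; \<open>ell2_realifyD\<close> carries this over to \<open>u\<close>.\<close>
  have "ell2 (\<lambda>k. \<Sum>\<^sub>\<infinity>i. realify_mat l b Z i k * realify_columns l b \<alpha> i j)"
    using isometry_mat_column_ell2[OF realify_columns_isometry_mat[OF \<alpha>]]
    by (rule op_bound_ell2[OF op_bound_transpose[OF Z]])
  then have "ell2 (realify l b u)"
    by (simp add: row mult.commute[of "realify_mat l b Z _ _"])
  then have u: "ell2 u" using u_supp by (rule ell2_realifyD)
  have "(adj (realify_columns l b \<alpha>) \<odot> realify_mat l b Z \<odot> realify_columns l b \<alpha>) j j'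
      = (\<Sum>\<^sub>\<infinity>k. realify l b u k * realify_columns l b \<alpha> k j')"
    by (simp add: mtimes_def adj_def row)
  also have "\<dots> = Re (\<Sum>\<^sub>\<infinity>k. cnj (u k) * \<alpha> k j')"
    unfolding realify_columns_def by (intro infsumI realify_has_sum u colA u_supp)
  also have "\<dots> = Re ((adj \<alpha> \<odot> Z \<odot> \<alpha>) j j')"
    by (simp add: mtimes_def adj_def u_def)
  finally show ?thesis .
qed

text \<open>As a real space, the range of \<alpha> is the orthogonal sum of the closed real spans of
  the columns of \<alpha> and of \<open>\<i>\<close> times \<alpha>.\<close>

lemma realify_mat_range_projection:
  assumes \<alpha>: "isometry_mat n m \<alpha>"
  defines "\<beta> \<equiv> realify_columns l b \<alpha>" and "\<gamma> \<equiv> realify_columns l b (\<lambda>i j. \<i> * \<alpha> i j)"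
  shows "realify_mat l b (\<alpha> \<odot> adj \<alpha>) i k = (\<beta> \<odot> adj \<beta>) i k + (\<gamma> \<odot> adj \<gamma>) i k"
proof (cases "i \<in> l \<and> k \<in> l")
  case True
  \<comment> \<open>With the conjugate unit of the copy \<open>b i\<close> absorbed, \<beta> and
    \<gamma> are the real part and minus the imaginary part of a single \<open>w\<close>.\<close>
  define w where "w = (\<lambda>i j. cnj (copy_unit (b i)) * \<alpha> (copy_index (b i)) j)"
  have \<beta>: "isometry_mat l m \<beta>" and \<gamma>: "isometry_mat l m \<gamma>"
    unfolding \<beta>_def \<gamma>_def by (intro realify_columns_isometry_mat isometry_mat_times_i \<alpha>)+
  have "\<beta> i j = Re (w i j)" "\<gamma> i j = - Im (w i j)" if "i \<in> l" for i j
    using that by (simp_all add: \<beta>_def \<gamma>_def realify_columns_def realify_def w_def)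
  then have eq: "\<beta> i j * \<beta> k j + \<gamma> i j * \<gamma> k j = Re (w i j * cnj (w k j))" for j
    using True by simp
  have "(\<beta> \<odot> adj \<beta>) i k + (\<gamma> \<odot> adj \<gamma>) i k = (\<Sum>\<^sub>\<infinity>j. \<beta> i j * \<beta> k j + \<gamma> i j * \<gamma> k j)"
    using \<beta> \<gamma> by (simp add: mtimes_def adj_def infsum_add ell2_mult_summable isometry_mat_row_ell2)
  also have "\<dots> = Re (\<Sum>\<^sub>\<infinity>j. w i j * cnj (w k j))"
    unfolding eq w_def complex_cnj_mult
    by (intro infsum_Re ell2_mult_summable ell2_cmult)
       (simp_all add: ell2_cnj isometry_mat_row_ell2[OF \<alpha>])
  also have "(\<Sum>\<^sub>\<infinity>j. w i j * cnj (w k j))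
      = cnj (copy_unit (b i)) * copy_unit (b k) * (\<alpha> \<odot> adj \<alpha>) (copy_index (b i)) (copy_index (b k))"
    by (simp add: w_def mtimes_def adj_def ac_simps flip: infsum_cmult_right')
  finally show ?thesis using True by (simp add: realify_mat_def)
qed (auto simp: realify_mat_def mtimes_def adj_def \<beta>_def \<gamma>_def realify_columns_def realify_def)

end

section \<open>Commutation for dilations in the complexification\<close>

lemma real_maximal_imp_complex_commutes:
  fixes N :: "nat \<Rightarrow> (nat \<Rightarrow> nat \<Rightarrow> 'v::real_vector) \<Rightarrow> real"
    and K :: "'k set \<Rightarrow> ('k, 'v \<Rightarrow> real) matr set"
  assumes conv: "nc_convex_set N K" and max: "nc_maximal K m x"
    and z: "z \<in> complexification N K n" and dil: "dilation n m \<alpha> z (complex_mat x (\<lambda>i j v. 0))"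
  shows "commutes_with z (\<alpha> \<odot> adj \<alpha>)"
  unfolding commutes_with_def
proof
  fix v
  obtain y w l b where z_eq: "z = complex_mat y w"
    and y: "y \<in> dual_matrices N n" and w: "w \<in> dual_matrices N n"
    and l: "l \<in> cardinals" and bij: "bij_betw b l (n <+> n)"
    and Y: "reindex l b (block_mat y w) \<in> K l"
    using z unfolding complexification_def by blast
  interpret doubling l n b by unfold_locales (rule bij)
  define Z where "Z = (\<lambda>v. eval_mat z v)"
  define R where "R = reindex l b (block_mat y w)"
  have eval_R: "eval_mat R v = realify_mat l b (Z v)" for v
    by (simp add: R_def Z_def z_eq eval_mat_reindex_block_mat)
  have "R \<in> dual_matrices N l"
    using conv[unfolded nc_convex_set_def, THEN conjunct1] Y l by (auto simp: R_def)
  then have bound: "\<exists>C. op_bound C (realify_mat l b (Z v))" for v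
    by (rule dual_matrices_eval_op_bound[of R N l v]) (auto simp: eval_R)
  have supp: "Z v i k = 0" if "i \<notin> n \<or> k \<notin> n" for v i k
    using y w that
    by (auto simp: dual_matrices_def Z_def eval_mat_def z_eq complex_mat_def Complex_eq_0)
  have Zv: "Z v = (\<lambda>i j. Complex (eval_mat y v i j) (eval_mat w v i j))" for v
    by (simp add: Z_def eval_mat_def z_eq complex_mat_def)
  have col: "ell2 (\<lambda>i. Z v i k)" and row: "ell2 (\<lambda>k. Z v i k)" for v i k
    unfolding Zv using y w
    by (auto intro!: ell2_Complex dual_matrices_eval_column_ell2 dual_matrices_eval_row_ell2)
  \<comment> \<open>Proved for every such isometry, since it is applied below both to \<alpha> and
    to \<open>\<i>\<close> times \<alpha>.\<close>
  have commutes: "commutes_with R (realify_columns l b \<alpha> \<odot> adj (realify_columns l b \<alpha>))"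
    if dil: "dilation n m \<alpha> z (complex_mat x (\<lambda>i j v. 0))" for \<alpha>
  proof -
    have \<alpha>: "isometry_mat n m \<alpha>" using dil by (simp add: dilation_def)
    have "complex_mat x (\<lambda>i j v. 0) = sandwich (adj \<alpha>) z \<alpha>"
      using dil by (simp add: dilation_def)
    \<comment> \<open>Real parts of the dilation equation are exactly what compression by the
      stacked columns produces.\<close>
    then have "x i j v = Re (sandwich (adj \<alpha>) z \<alpha> i j v)" for i j v
      by (auto simp: complex_mat_def fun_eq_iff complex_eq_iff)
    moreover have "sandwich (adj (realify_columns l b \<alpha>)) R (realify_columns l b \<alpha>) i j v
        = Re (sandwich (adj \<alpha>) z \<alpha> i j v)" for i j v
      using bound[of v] realify_columns_compression[OF \<alpha> _ col supp]
      by (auto simp: sandwich_def eval_R Z_def)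
    ultimately have "dilation l m (realify_columns l b \<alpha>) R x"
      by (simp add: dilation_def realify_columns_isometry_mat[OF \<alpha>] fun_eq_iff)
    then show ?thesis
      using max[unfolded nc_maximal_def, THEN conjunct2, rule_format, OF l Y] by (simp add: R_def)
  qed
  have \<alpha>: "isometry_mat n m \<alpha>" using dil by (simp add: dilation_def)
  define \<beta> where "\<beta> = realify_columns l b \<alpha>"
  define \<gamma> where "\<gamma> = realify_columns l b (\<lambda>i j. \<i> * \<alpha> i j)"
  have \<beta>: "isometry_mat l m \<beta>" and \<gamma>: "isometry_mat l m \<gamma>"
    unfolding \<beta>_def \<gamma>_def by (intro realify_columns_isometry_mat isometry_mat_times_i \<alpha>)+
  define P where "P = \<alpha> \<odot> adj \<alpha>"
  define B where "B = \<beta> \<odot> adj \<beta>"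
  define G where "G = \<gamma> \<odot> adj \<gamma>"
  define S where "S = realify_mat l b (Z v)"
  have BS: "B \<odot> S = S \<odot> B" and GS: "G \<odot> S = S \<odot> G"
    using commutes[OF dil] commutes[OF dilation_times_i[OF dil]]
    by (simp_all add: commutes_with_def eval_R B_def G_def \<beta>_def \<gamma>_def S_def)
  obtain C where "op_bound C S" using bound S_def by blast
  then have S: "ell2 (\<lambda>i. S i k)" "ell2 (\<lambda>k. S i k)" for i k
    by (rule op_bound_column_ell2, rule op_bound_row_ell2)
  have B: "ell2 (\<lambda>i. B i k)" "ell2 (\<lambda>i. B k i)" and G: "ell2 (\<lambda>i. G i k)" "ell2 (\<lambda>i. G k i)" for k
    unfolding B_def G_def
    using range_projection_column_ell2_real[OF \<beta>] range_projection_column_ell2_real[OF \<gamma>]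
    by (simp_all add: range_projection_adj_real[of _ k])
  have P: "realify_mat l b P = (\<lambda>i k. B i k + G i k)"
    using realify_mat_range_projection[OF \<alpha>] by (simp add: P_def B_def G_def \<beta>_def \<gamma>_def fun_eq_iff)
  \<comment> \<open>Adding the two commutation relations requires distributivity of the product; it
    holds because square summability makes all entry sums converge.\<close>
  have "realify_mat l b P \<odot> S = (\<lambda>i k. (B \<odot> S) i k + (G \<odot> S) i k)"
    unfolding P using B G S by (simp add: mtimes_def distrib_right infsum_add ell2_mult_summable)
  also have "\<dots> = S \<odot> realify_mat l b P"
    unfolding P BS GS using B G S by (simp add: mtimes_def distrib_left infsum_add ell2_mult_summable)
  finally have comm: "realify_mat l b P \<odot> S = S \<odot> realify_mat l b P" .
  have P_col: "ell2 (\<lambda>i. P i k)" for k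
    unfolding P_def by (rule range_projection_column_ell2_complex[OF \<alpha>])
  have P_row: "ell2 (\<lambda>k. P i k)" for i
    using P_col[of i] unfolding P_def by (subst range_projection_adj_complex) (simp add: ell2_cnj)
  have P_supp: "P i k = 0" if "i \<notin> n \<or> k \<notin> n" for i k
    using that isometry_mat_supp[OF \<alpha>] by (auto simp: P_def mtimes_def adj_def)
  \<comment> \<open>Both products are realifications of complex products, so commutation is pulled
    back by injectivity.\<close>
  have "realify_mat l b P \<odot> S = realify_mat l b (P \<odot> Z v)"
    unfolding S_def by (rule realify_mat_mtimes[OF P_row col]) (simp add: P_supp)
  moreover have "S \<odot> realify_mat l b P = realify_mat l b (Z v \<odot> P)"
    unfolding S_def by (rule realify_mat_mtimes[OF row P_col]) (simp add: supp)
  ultimately have "realify_mat l b (P \<odot> Z v) = realify_mat l b (Z v \<odot> P)"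
    using comm by simp
  then have "P \<odot> Z v = Z v \<odot> P"
    by (rule realify_mat_inject) (use P_supp supp in \<open>auto simp: mtimes_def\<close>)
  then show "(\<alpha> \<odot> adj \<alpha>) \<odot> eval_mat z v = eval_mat z v \<odot> (\<alpha> \<odot> adj \<alpha>)"
    by (simp add: P_def Z_def)
qed

section \<open>Direct sums of two copies\<close>

text \<open>If \<open>f\<close> maps \<open>S\<close> bijectively onto \<open>n\<close>, this
  isometry sends the basis vector at \<open>f i\<close> to the basis vector at
  \<open>i\<close>.\<close>

definition embedding_mat :: "'k set \<Rightarrow> ('k \<Rightarrow> 'k) \<Rightarrow> ('k, real) matr" where
  "embedding_mat S f i j = of_bool (i \<in> S \<and> j = f i)"

lemma embedding_mat_mtimes: "(embedding_mat S f \<odot> A) i j = (if i \<in> S then A (f i) j else 0)"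
  unfolding mtimes_def by (subst infsum_single[of "f i"]) (auto simp: embedding_mat_def)

lemma mtimes_adj_embedding_mat: "(A \<odot> adj (embedding_mat S f)) i j = (if j \<in> S then A i (f j) else 0)"
  unfolding mtimes_def adj_def by (subst infsum_single[of "f j"]) (auto simp: embedding_mat_def)

lemma sandwich_embedding_mat:
  "sandwich (embedding_mat S f) x (adj (embedding_mat S f)) i j v
    = (if i \<in> S \<and> j \<in> S then x (f i) (f j) v else 0)"
  by (simp add: sandwich_def mtimes_adj_embedding_mat embedding_mat_mtimes eval_mat_def)

lemma isometry_mat_embedding_mat:
  assumes "bij_betw f S n" "S \<subseteq> l"
  shows "isometry_mat l n (embedding_mat S f)"
proof (rule isometry_mat_realI)
  show "embedding_mat S f i j = 0" if "i \<notin> l \<or> j \<notin> n" for i j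
    using assms that by (auto simp: embedding_mat_def bij_betw_def)
  show "adj (embedding_mat S f) \<odot> embedding_mat S f = one_mat n"
  proof (intro ext)
    fix j j'
    show "(adj (embedding_mat S f) \<odot> embedding_mat S f) j j' = one_mat n j j'"
    proof (cases "j \<in> n")
      case True
      then obtain i where i: "i \<in> S" "f i = j" using assms(1) by (auto simp: bij_betw_def)
      have "i' = i" if "i' \<in> S" "f i' = j" for i'
        using that i assms(1) by (auto simp: bij_betw_def inj_on_def)
      then have "(adj (embedding_mat S f) \<odot> embedding_mat S f) j j'
          = embedding_mat S f i j * embedding_mat S f i j'"
        unfolding mtimes_def adj_def
        by (subst infsum_single[of i]) (auto simp: embedding_mat_def)
      then show ?thesis using i True by (auto simp: embedding_mat_def one_mat_def)
    next
      case False
      then have "embedding_mat S f i j = 0" for i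
        using assms(1) by (auto simp: embedding_mat_def bij_betw_def)
      then show ?thesis using False by (simp add: mtimes_def adj_def one_mat_def)
    qed
  qed
qed

lemma embedding_mat_range_projection:
  assumes "inj_on f S"
  shows "embedding_mat S f \<odot> adj (embedding_mat S f) = one_mat S"
  using assms by (auto simp: fun_eq_iff embedding_mat_mtimes adj_def embedding_mat_def one_mat_def inj_on_def)

text \<open>The identity \<open>\<kappa> + \<kappa> = \<kappa>\<close> for infinite \<kappa> embeds
  \<open>n <+> n\<close> into the index type, where its image has a cardinal as
  representative.\<close>

lemma ex_cardinal_double:
  assumes "infinite (UNIV :: 'k set)" "(n :: 'k set) \<noteq> {}"
  shows "\<exists>l \<in> (cardinals :: 'k set set). \<exists>b. bij_betw b l (n <+> n)"
proof -
  obtain g :: "'k + 'k \<Rightarrow> 'k" where "bij_betw g (UNIV <+> UNIV) UNIV"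
    using card_of_Plus_infinite1[OF assms(1) card_of_mono1[OF subset_refl]]
    unfolding card_of_ordIso[symmetric] by blast
  then have "inj_on g (n <+> n)"
    by (simp add: bij_betw_def inj_on_subset[OF _ subset_UNIV])
  then have g: "g ` (n <+> n) \<approx> n <+> n"
    by (rule inj_on_image_eqpoll_self)
  have "g ` (n <+> n) \<noteq> {}" using assms(2) by auto
  from ex1_implies_ex[OF ex1_cardinal[OF this]]
  obtain l :: "'k set" where l: "l \<in> cardinals" "l \<approx> g ` (n <+> n)" by blast
  from eqpoll_trans[OF l(2) g] show ?thesis using l(1) unfolding eqpoll_def by blast
qed

lemma opnorm_zero: "opnorm I J (\<lambda>_ _. 0) \<le> 0"
  by (rule opnorm_leI) (simp add: L2_set_0')

lemma zero_dual_matrices: "(\<lambda>i j v. 0) \<in> dual_matrices N n"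
proof -
  have "bdd_by N n 0 (\<lambda>i j v. 0)"
    by (simp add: bdd_by_def norm_le_def case_prod_unfold opnorm_zero)
  then show ?thesis
    by (auto simp: dual_matrices_def dual_space_def linear_iff intro!: exI[of _ 0])
qed

lemma nc_convex_set_double:
  fixes K :: "'k set \<Rightarrow> ('k, 'v::real_vector \<Rightarrow> real) matr set"
  assumes conv: "nc_convex_set N K" and inf: "infinite (UNIV :: 'k set)"
    and n: "n \<in> cardinals" and l: "l \<in> cardinals" and bij: "bij_betw b l (n <+> n)" and y: "y \<in> K n"
  shows "reindex l b (block_mat y (\<lambda>i j v. 0)) \<in> K l"
proof -
  \<comment> \<open>Families of summands are indexed by elements of \<open>'k\<close>; two distinct
    ones label the two copies of \<open>y\<close>.\<close>
  obtain t0 t1 :: 'k where t: "t0 \<noteq> t1"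
    using inf by (metis finite.emptyI finite_insert insertI1 subsetI rev_finite_subset)
  \<comment> \<open>\<open>S t0\<close> is the part of \<open>l\<close> matched with the first copy
    of \<open>n\<close>; any index other than \<open>t0\<close> selects the second.\<close>
  define S where "S = (\<lambda>t. {i \<in> l. b i \<in> (if t = t0 then Inl else Inr) ` n})"
  define f where "f = (\<lambda>i. copy_index (b i))"
  define \<alpha> where "\<alpha> = (\<lambda>t. embedding_mat (S t) f)"
  have bl: "inj_on b l" "b ` l = n <+> n" using bij by (auto simp: bij_betw_def)
  have S: "bij_betw f (S t) n" for t
  proof -
    have "inj_on f (S t)"
      using bl(1) by (auto simp: inj_on_def S_def f_def split: if_splits)
    moreover have "f ` S t = n"
    proof
      show "n \<subseteq> f ` S t"
      proof
        fix a assume a: "a \<in> n"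
        then have "(if t = t0 then Inl a else Inr a) \<in> b ` l" unfolding bl by auto
        then obtain i where "i \<in> l" "b i = (if t = t0 then Inl a else Inr a)" by (metis imageE)
        then have "i \<in> S t" "f i = a" using a by (auto simp: S_def f_def)
        then show "a \<in> f ` S t" by blast
      qed
    qed (auto simp: S_def f_def split: if_splits)
    ultimately show ?thesis by (simp add: bij_betw_def)
  qed
  have iso: "isometry_mat l n (\<alpha> t)" for t
    unfolding \<alpha>_def by (rule isometry_mat_embedding_mat[OF S]) (auto simp: S_def)
  have "b i \<in> n <+> n" if "i \<in> l" for i using bl that by blast
  then have l_eq: "i \<in> l \<longleftrightarrow> i \<in> S t0 \<or> i \<in> S t1" for i
    using t by (fastforce simp: S_def)
  have disj: "\<not> (i \<in> S t0 \<and> i \<in> S t1)" for i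
    using t by (auto simp: S_def)
  have proj: "\<alpha> t \<odot> adj (\<alpha> t) = one_mat (S t)" for t
    unfolding \<alpha>_def by (rule embedding_mat_range_projection[OF bij_betw_imp_inj_on[OF S]])
  \<comment> \<open>The two parts are disjoint and cover \<open>l\<close>, so their diagonal
    projections add up to the identity.\<close>
  have one: "(\<lambda>i j. \<Sum>\<^sub>\<infinity>t\<in>{t0, t1}. (\<alpha> t \<odot> adj (\<alpha> t)) i j) = one_mat l"
    using t disj by (auto simp: proj fun_eq_iff one_mat_def l_eq)
  have "y \<in> dual_matrices N n"
    using conv[unfolded nc_convex_set_def, THEN conjunct1] n y by auto
  then obtain C where C: "bdd_by N n C y"
    unfolding dual_matrices_def by auto
  have "(\<lambda>i j v. \<Sum>\<^sub>\<infinity>t\<in>{t0, t1}. sandwich (\<alpha> t) y (adj (\<alpha> t)) i j v) \<in> K l"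
    by (rule conv[unfolded nc_convex_set_def, THEN conjunct2, THEN conjunct1, rule_format,
        OF l, of "{t0, t1}" "\<lambda>_. n" "\<lambda>_. y" C \<alpha>]) (use n y C iso one in blast)
  also have "(\<lambda>i j v. \<Sum>\<^sub>\<infinity>t\<in>{t0, t1}. sandwich (\<alpha> t) y (adj (\<alpha> t)) i j v)
      = reindex l b (block_mat y (\<lambda>i j v. 0))"
  proof (intro ext)
    fix i j v
    have lhs: "(\<Sum>\<^sub>\<infinity>t\<in>{t0, t1}. sandwich (\<alpha> t) y (adj (\<alpha> t)) i j v)
      = (if i \<in> S t0 \<and> j \<in> S t0 then y (f i) (f j) v else 0)
      + (if i \<in> S t1 \<and> j \<in> S t1 then y (f i) (f j) v else 0)"
      using t by (simp add: \<alpha>_def sandwich_embedding_mat)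
    have copy: "i \<in> S t0 \<Longrightarrow> b i = Inl (f i)" "i \<in> S t1 \<Longrightarrow> b i = Inr (f i)" for i
      using t by (auto simp: S_def f_def)
    \<comment> \<open>Entries with \<open>i\<close> and \<open>j\<close> in different parts vanish
      on the left by disjointness and on the right because the imaginary part is 0.\<close>
    show "(\<Sum>\<^sub>\<infinity>t\<in>{t0, t1}. sandwich (\<alpha> t) y (adj (\<alpha> t)) i j v)
        = reindex l b (block_mat y (\<lambda>i j v. 0)) i j v"
      unfolding lhs reindex_def l_eq using disj[of i] disj[of j] copy[of i] copy[of j]
      by auto
  qed
  finally show ?thesis .
qed

section \<open>Points and real dilations of \<open>K\<close> inside the complexification\<close>

lemma nc_convex_set_complexification:
  fixes K :: "'k set \<Rightarrow> ('k, 'v::real_vector \<Rightarrow> real) matr set"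
  assumes conv: "nc_convex_set N K" and inf: "infinite (UNIV :: 'k set)"
    and n: "n \<in> cardinals" and y: "y \<in> K n"
  shows "complex_mat y (\<lambda>i j v. 0) \<in> complexification N K n"
proof -
  have "n \<noteq> {}" using n by (simp add: cardinals_def)
  from ex_cardinal_double[OF inf this]
  obtain l :: "'k set" and b where l: "l \<in> cardinals" "bij_betw b l (n <+> n)" by blast
  have "y \<in> dual_matrices N n"
    using conv[unfolded nc_convex_set_def, THEN conjunct1] n y by auto
  then show ?thesis
    unfolding complexification_def mem_Collect_eq
    by (intro exI[of _ y] exI[of _ "\<lambda>i j v. 0"] exI[of _ b] bexI[of _ l] conjI refl
        zero_dual_matrices nc_convex_set_double[OF conv inf n l y] l)
qed

lemma eval_mat_complex_mat_zero:
  "eval_mat (complex_mat y (\<lambda>i j v. 0)) v = complex_of_real_mat (eval_mat y v)"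
  by (simp add: eval_mat_def complex_mat_def complex_of_real_mat_def complex_of_real_def)

lemma dilation_complex_of_real_mat:
  assumes "dilation n m \<alpha> y x"
  shows "dilation n m (complex_of_real_mat \<alpha>)
    (complex_mat y (\<lambda>i j v. 0)) (complex_mat x (\<lambda>i j v. 0))"
proof -
  have "sandwich (adj (complex_of_real_mat \<alpha>)) (complex_mat y (\<lambda>i j v. 0)) (complex_of_real_mat \<alpha>)
      = (\<lambda>i j v. complex_of_real_mat (adj \<alpha> \<odot> eval_mat y v \<odot> \<alpha>) i j)"
    by (simp add: sandwich_def eval_mat_complex_mat_zero complex_of_real_mat_mtimes complex_of_real_mat_adj)
  also have "\<dots> = complex_mat (sandwich (adj \<alpha>) y \<alpha>) (\<lambda>i j v. 0)"
    by (simp add: complex_of_real_mat_def complex_mat_def sandwich_def complex_of_real_def)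
  finally show ?thesis
    using assms by (simp add: dilation_def isometry_mat_complex_of_real_mat)
qed

text \<open>Real matrices embed injectively and multiplicatively into complex ones, so commutation
  can be tested after the embedding.\<close>

lemma commutes_with_complex_of_real_matD:
  assumes "commutes_with (complex_mat y (\<lambda>i j v. 0))
    (complex_of_real_mat \<alpha> \<odot> adj (complex_of_real_mat \<alpha>))"
  shows "commutes_with y (\<alpha> \<odot> adj \<alpha>)"
  using assms unfolding commutes_with_def eval_mat_complex_mat_zero
  by (simp add: complex_of_real_mat_inject flip: complex_of_real_mat_mtimes complex_of_real_mat_adj)

theorem corollary2p7:
  fixes N :: "nat \<Rightarrow> (nat \<Rightarrow> nat \<Rightarrow> 'v::real_vector) \<Rightarrow> real"
    and K :: "'k set \<Rightarrow> ('k \<Rightarrow> 'k \<Rightarrow> 'v \<Rightarrow> real) set"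
    and m :: "'k set"
    and x :: "'k \<Rightarrow> 'k \<Rightarrow> 'v \<Rightarrow> real"
  assumes "infinite (UNIV :: 'k set)"
    and "real_operator_space N"
    and "compact_nc_convex_set N K"
    and "m \<in> cardinals"
    and "x \<in> K m"
  shows "nc_maximal K m x \<longleftrightarrow>
    nc_maximal (complexification N K) m (complex_mat x (\<lambda>i j v. 0))"
proof -
  have conv: "nc_convex_set N K"
    using assms(3) by (simp add: compact_nc_convex_set_def)
  note lift = nc_convex_set_complexification[OF conv assms(1)]
  show ?thesis
  proof
    assume "nc_maximal K m x"
    then show "nc_maximal (complexification N K) m (complex_mat x (\<lambda>i j v. 0))"
      using real_maximal_imp_complex_commutes[OF conv] lift[OF assms(4,5)]
      by (auto simp: nc_maximal_def)
  next
    assume max: "nc_maximal (complexification N K) m (complex_mat x (\<lambda>i j v. 0))"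
    \<comment> \<open>A real dilation becomes a complex one, and the commutation given by complex
      maximality descends to the real matrices.\<close>
    have "commutes_with y (\<alpha> \<odot> adj \<alpha>)"
      if "n \<in> cardinals" "y \<in> K n" "dilation n m \<alpha> y x" for n y \<alpha>
      using max[unfolded nc_maximal_def, THEN conjunct2, rule_format,
          OF that(1) lift[OF that(1,2)] dilation_complex_of_real_mat[OF that(3)]]
      by (rule commutes_with_complex_of_real_matD)
    then show "nc_maximal K m x" using assms(5) by (simp add: nc_maximal_def)
  qed
qed

end
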